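(* Let $k \geq 3$ be an integer and let $n$ be a nonzero integer. If $|n|=1$, then $BM_k(n)\leq r_k+1$, where $r_3=9$, $r_4=6$, $r_5=5$, and $r_k=4$ for $k \geq 6$. If $|n|\geq 2$, then $$BM_k(n) \leq \max\left\{\frac{\log \log |n|+3.3}{\log (k-1)}+8,\ \left(\max\{4|n|^2,|n|^{2(k+1)/(k-2)}\}+n\right)^{1/k}+20\right\}.$$
   Context: $\mathbb{N}$ denotes the set of positive integers and $\log$ is the natural logarithm. For an integer $k\ge 3$ and a nonzero integer $n$, a pair $(A,B)$ of subsets of $\mathbb{N}$ is said to have property $BD_k(n)$ if $|A|,|B|\geq 2$ and $ab+n\in\{x^k: x\in\mathbb{N}\}$ for every $a\in A$ and $b\in B$. Define $BM_k(n)=\sup\{\min\{|A|,|B|\}: (A,B)\text{ has property } BD_k(n)\}$. *)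

theory Defs
  imports Complex_Main "HOL-Library.Extended_Real"
begin

text \<open>
  \<^const>\<open>card\<close> is \<open>0\<close> on infinite sets, so the sizes are taken in \<^typ>\<open>enat\<close>; all sets
  considered here are countable, so a single infinite value suffices.
\<close>

definition ecard :: "'a set \<Rightarrow> enat" where
  "ecard A = (if finite A then enat (card A) else \<infinity>)"

definition BD :: "nat \<Rightarrow> int \<Rightarrow> nat set \<Rightarrow> nat set \<Rightarrow> bool" where
  "BD k n A B \<longleftrightarrow>
     A \<subseteq> {1..} \<and> B \<subseteq> {1..} \<and> ecard A \<ge> 2 \<and> ecard B \<ge> 2 \<and>
     (\<forall>a\<in>A. \<forall>b\<in>B. int a * int b + n \<in> {int x ^ k | x :: nat. x \<ge> 1})"

text \<open>If no pair has the property, the supremum is that of the empty set, which is \<open>0\<close> in \<^typ>\<open>enat\<close>.\<close>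

definition BM :: "nat \<Rightarrow> int \<Rightarrow> enat" where
  "BM k n = Sup {min (ecard A) (ecard B) | A B. BD k n A B}"

definition r_bd :: "nat \<Rightarrow> nat" where
  "r_bd k = (if k = 3 then 9 else if k = 4 then 6 else if k = 5 then 5 else 4)"

end

theory Submission
  imports Defs "HOL-Analysis.Analysis" "HOL-Number_Theory.Cong" "HOL-Library.Landau_Symbols"
begin

text \<open>
  Fix \<open>a < a'\<close> in \<open>A\<close>. Every \<open>b \<in> B\<close> gives a solution \<open>x\<^sup>k = ab + n\<close>, \<open>y\<^sup>k = a'b + n\<close> of the Thue equation
  \<open>a' x\<^sup>k - a y\<^sup>k = n (a' - a)\<close>, so that \<open>x / y\<close> is an excellent approximation to \<open>(a / a')\<^bsup>1/k\<^esup>\<close>.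
  Following Thue and Siegel, one such \<open>b\<close>, large compared with \<open>a'\<close> and \<open>n\<close>, is fed into the diagonal Pade
  approximants of \<open>T \<mapsto> T\<^bsup>1/k\<^esup>\<close>; comparing the resulting approximations with the one given by a second
  \<open>b' > b\<close> produces a nonzero integer of absolute value below \<open>1\<close>, unless \<open>b'\<close> is small.
  On the other hand, for \<open>a < a'\<close> and \<open>b < b'\<close> the integers \<open>(ab + n)(a'b' + n)\<close> and \<open>(ab' + n)(a'b + n)\<close> are
  distinct \<open>k\<close>-th powers that are close together, whence \<open>\<bar>n\<bar>\<^sup>k a'b' \<ge> (ab)\<^bsup>k - 1\<^esup>\<close>. This gap principle
  makes the elements grow doubly exponentially, so that a few elements beyond the initial range \<open>ab \<le> M\<close>,
  where \<open>M\<close> is the maximum of \<open>4n\<^sup>2\<close> and \<open>\<bar>n\<bar>\<^bsup>2(k+1)/(k-2)\<^esup>\<close>, already contain suitable \<open>b\<close> and \<open>b'\<close>.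
  For a fixed \<open>a\<close> that range contains at most \<open>(M + n)\<^bsup>1/k\<^esup>\<close> values of \<open>b\<close>, one for each possible \<open>k\<close>-th root.
  This gives \<open>(M + n)\<^bsup>1/k\<^esup> + 20\<close> for all \<open>\<bar>n\<bar> \<ge> 2\<close>.
\<close>

section \<open>Integrality of binomial coefficients with rational upper index\<close>

lemma multiplicity_fact:
  fixes p :: nat
  assumes "prime p"
  shows "multiplicity p (fact m :: nat) = m div p + multiplicity p (fact (m div p) :: nat)"
proof -
  have p_pos: "p > 0" using assms by (rule prime_gt_0_nat)
  have multiplicity_sum: "multiplicity p (fact m :: nat) = (\<Sum>i=1..m. multiplicity p i)" for m
    unfolding fact_prod of_nat_id using assms
    by (subst prime_elem_multiplicity_prod_distrib) auto
  have multiples: "{i\<in>{1..m}. p dvd i} = (*) p ` {1..m div p}"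
  proof (intro equalityI subsetI)
    fix i assume "i \<in> {i\<in>{1..m}. p dvd i}"
    then have "i = p * (i div p)" "i div p \<in> {1..m div p}"
      using p_pos by (auto intro: div_le_mono simp: Suc_le_eq dvd_div_eq_0_iff)
    then show "i \<in> (*) p ` {1..m div p}" by (rule image_eqI)
  qed (use p_pos in \<open>auto simp: less_eq_div_iff_mult_less_eq mult.commute\<close>)
  have "(\<Sum>i=1..m. multiplicity p i) = (\<Sum>i | i \<in> {1..m} \<and> p dvd i. multiplicity p i)"
    by (rule sum.mono_neutral_right) (auto simp: not_dvd_imp_multiplicity_0)
  also have "\<dots> = (\<Sum>j=1..m div p. multiplicity p (p * j))"
    unfolding multiples using p_pos by (subst sum.reindex) (auto simp: inj_on_def)
  also have "\<dots> = (\<Sum>j=1..m div p. 1 + multiplicity p j)"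
    using assms by (intro sum.cong refl, subst multiplicity_times_same) auto
  finally show ?thesis by (simp only: multiplicity_sum sum.distrib) simp
qed

lemma multiplicity_fact_le:
  fixes p :: nat
  assumes "prime p"
  shows "multiplicity p (fact m :: nat) \<le> m"
proof (induction m rule: less_induct)
  case (less m)
  have p_ge_2: "p \<ge> 2" using assms by (rule prime_ge_2_nat)
  show ?case
  proof (cases "m = 0")
    case False
    have "multiplicity p (fact m :: nat) \<le> m div p + m div p"
      using less.IH[of "m div p"] False p_ge_2 multiplicity_fact[OF assms, of m] by simp
    also have "\<dots> \<le> p * (m div p)" using mult_le_mono1[OF p_ge_2, of "m div p"] by linarith
    also have "\<dots> \<le> m" by simp
    finally show ?thesis .
  qed simp
qed

lemma coprime_dvd_fact_imp_dvd_prod: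
  fixes d k x :: int
  assumes "coprime k d" "d dvd fact m"
  shows "d dvd (\<Prod>s<m. x - k * int s)"
proof -
  obtain K where inverse: "[- k * K = 1] (mod d)"
    using cong_solve_coprime_int[of "- k" d] assms(1) by auto
  have "[(\<Prod>s<m. K * (x - k * int s)) = (\<Prod>s<m. K * x + int s)] (mod d)"
  proof (rule cong_prod)
    fix s
    have "[K * x + (- k * K) * int s = K * x + 1 * int s] (mod d)"
      by (intro cong_add cong_mult cong_refl inverse)
    then show "[K * (x - k * int s) = K * x + int s] (mod d)" by (simp add: algebra_simps)
  qed
  moreover have "d dvd (\<Prod>s<m. K * x + int s)"
    using dvd_trans[OF assms(2) fact_dvd_pochhammer[of m "K * x"]]
    by (simp add: pochhammer_prod atLeast0LessThan)
  ultimately have "d dvd (\<Prod>s<m. K * (x - k * int s))" by (simp add: cong_dvd_iff)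
  then have "d dvd K ^ m * (\<Prod>s<m. x - k * int s)" by (simp add: prod.distrib)
  moreover have "coprime d (K ^ m)"
  proof -
    have "coprime (- k * K) d" using inverse by (metis cong_imp_coprime coprime_1_left cong_sym)
    then show ?thesis by (simp add: coprime_commute)
  qed
  ultimately show ?thesis by (simp add: coprime_dvd_mult_right_iff)
qed

lemma fact_dvd_power_mult_prod:
  fixes k x :: int
  shows "fact m dvd k ^ m * (\<Prod>s<m. x - k * int s)"
proof (cases "k ^ m * (\<Prod>s<m. x - k * int s) = 0")
  case nonzero: False
  define y where "y = k ^ m * (\<Prod>s<m. x - k * int s)"
  have "fact m dvd nat \<bar>y\<bar>"
  proof (rule multiplicity_le_imp_dvd)
    fix p :: nat assume p: "prime p"
    define e where "e = multiplicity p (fact m :: nat)"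
    have "int (p ^ e) dvd y"
    proof (cases "int p dvd k")
      case True
      have "int p ^ e dvd int p ^ m"
        unfolding e_def by (intro le_imp_power_dvd multiplicity_fact_le p)
      also have "\<dots> dvd k ^ m" using True by (rule dvd_power_same)
      finally show ?thesis by (simp add: y_def)
    next
      case False
      then have "coprime k (int (p ^ e))"
        using p prime_imp_coprime[of "int p" k] by (simp add: coprime_commute)
      moreover have "int (p ^ e) dvd fact m"
        using multiplicity_dvd[of p "fact m :: nat"]
        unfolding e_def of_nat_fact[symmetric, where ?'a = int] of_nat_dvd_iff .
      ultimately show ?thesis unfolding y_def by (intro dvd_mult coprime_dvd_fact_imp_dvd_prod)
    qed
    then have "p ^ e dvd nat \<bar>y\<bar>" by simp
    then show "multiplicity p (fact m) \<le> multiplicity p (nat \<bar>y\<bar>)"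
      using nonzero p by (intro multiplicity_geI) (auto simp: e_def y_def)
  qed simp
  then show ?thesis by (simp add: y_def)
qed (simp only: dvd_0_right)

lemma power_mult_gbinomial_Ints:
  fixes k x :: int
  assumes "k \<noteq> 0"
  shows "of_int k ^ (2 * m) * ((of_int x / of_int k :: 'a::field_char_0) gchoose m) \<in> \<int>"
proof -
  obtain c where c: "k ^ m * (\<Prod>s<m. x - k * int s) = fact m * c"
    using fact_dvd_power_mult_prod[of m k x] by (elim dvdE)
  have "fact m * (of_int k ^ (2 * m) * ((of_int x / of_int k :: 'a) gchoose m))
      = of_int k ^ m * (of_int k ^ m * (\<Prod>s<m. of_int x / of_int k - of_nat s))"
    by (simp only: mult_2 power_add gbinomial_mult_fact[symmetric] atLeast0LessThan[symmetric])
       (simp only: mult_ac)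
  also have "of_int k ^ m * (\<Prod>s<m. of_int x / of_int k - of_nat s :: 'a) = of_int (\<Prod>s<m. x - k * int s)"
  proof -
    have "of_int k ^ m * (\<Prod>s<m. of_int x / of_int k - of_nat s :: 'a)
        = (\<Prod>s<m. of_int k * (of_int x / of_int k - of_nat s))"
      by (simp add: prod.distrib)
    also have "\<dots> = (\<Prod>s<m. of_int x - of_int k * of_nat s)"
      using assms by (simp add: right_diff_distrib)
    finally show ?thesis by simp
  qed
  also have "of_int k ^ m * (of_int (\<Prod>s<m. x - k * int s) :: 'a) = of_int (fact m * c)"
    by (simp only: c of_int_mult[symmetric] of_int_power[symmetric])
  also have "\<dots> = fact m * of_int c" by simp
  finally have "of_int k ^ (2 * m) * ((of_int x / of_int k :: 'a) gchoose m) = of_int c" by simp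
  then show ?thesis by simp
qed

section \<open>Divided differences\<close>

definition divided_difference :: "('a \<Rightarrow> 'a) \<Rightarrow> 'a set \<Rightarrow> 'a::field" where
  "divided_difference f S = (\<Sum>x\<in>S. f x / (\<Prod>y\<in>S - {x}. x - y))"

lemma divided_difference_singleton [simp]: "divided_difference f {x} = f x"
  by (simp add: divided_difference_def)

lemma divided_difference_minus_node_mult:
  assumes "finite S" "m \<in> S"
  shows "divided_difference (\<lambda>x. (x - m) * f x) S = divided_difference f (S - {m})"
proof -
  have "divided_difference (\<lambda>x. (x - m) * f x) S
      = (\<Sum>x\<in>S - {m}. (x - m) * f x / (\<Prod>y\<in>S - {x}. x - y))"
    unfolding divided_difference_def using assms by (subst sum.remove[of S m]) auto
  also have "\<dots> = divided_difference f (S - {m})"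
    unfolding divided_difference_def
  proof (rule sum.cong[OF refl])
    fix x assume x: "x \<in> S - {m}"
    have "(\<Prod>y\<in>S - {x}. x - y) = (x - m) * (\<Prod>y\<in>S - {m} - {x}. x - y)"
      using prod.remove[of "S - {x}" m "\<lambda>y. x - y"] assms x
      by (auto simp: Diff_insert2[symmetric] Diff_insert[symmetric] insert_commute)
    then show "(x - m) * f x / (\<Prod>y\<in>S - {x}. x - y) = f x / (\<Prod>y\<in>S - {m} - {x}. x - y)"
      using x by simp
  qed
  finally show ?thesis .
qed

lemma divided_difference_const:
  assumes "finite S" "card S \<ge> 2"
  shows "divided_difference (\<lambda>_. c) S = 0"
  using assms
proof (induction "card S" arbitrary: S rule: less_induct)
  case less
  obtain m m' where nodes: "m \<in> S" "m' \<in> S" "m \<noteq> m'"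
    using less.prems by (metis One_nat_def card_le_Suc0_iff_eq not_less_eq_eq numeral_2_eq_2)
  have "(m' - m) * divided_difference (\<lambda>_. c) S
      = divided_difference (\<lambda>x. (x - m) * c) S - divided_difference (\<lambda>x. (x - m') * c) S"
    unfolding divided_difference_def sum_distrib_left sum_subtractf[symmetric]
    by (intro sum.cong refl) (simp add: diff_divide_distrib[symmetric] algebra_simps)
  also have "\<dots> = divided_difference (\<lambda>_. c) (S - {m}) - divided_difference (\<lambda>_. c) (S - {m'})"
    using less.prems(1) nodes by (simp add: divided_difference_minus_node_mult)
  also have "divided_difference (\<lambda>_. c) (S - {m}) = divided_difference (\<lambda>_. c) (S - {m'})"
  proof (cases "card S = 2")
    case True
    then have "S = {m, m'}" using nodes less.prems(1)
      by (metis card_2_iff doubleton_eq_iff insertE singletonD)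
    then have "S - {m} = {m'}" "S - {m'} = {m}" using nodes by auto
    then show ?thesis by simp
  next
    case False
    then show ?thesis using less.hyps[of "S - {m}"] less.hyps[of "S - {m'}"] less.prems nodes by simp
  qed
  finally show ?case using nodes by simp
qed

lemma has_real_derivative_divided_difference_exp:
  fixes S :: "real set"
  assumes "finite S" "m \<in> S"
  shows "((\<lambda>t. divided_difference (\<lambda>x. exp (x * t)) S * exp (- m * t)) has_real_derivative
      divided_difference (\<lambda>x. exp (x * t)) (S - {m}) * exp (- m * t)) (at t)"
proof -
  have "((\<lambda>t. divided_difference (\<lambda>x. exp (x * t)) S) has_real_derivative
      divided_difference (\<lambda>x. x * exp (x * t)) S) (at t)"
    unfolding divided_difference_def
    by (intro DERIV_sum DERIV_cdivide) (auto intro!: derivative_eq_intros)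
  also have "divided_difference (\<lambda>x. x * exp (x * t)) S
      = divided_difference (\<lambda>x. (x - m) * exp (x * t)) S + m * divided_difference (\<lambda>x. exp (x * t)) S"
    unfolding divided_difference_def sum_distrib_left sum.distrib[symmetric]
    by (intro sum.cong refl) (simp add: add_divide_distrib[symmetric] algebra_simps)
  finally show ?thesis
    unfolding divided_difference_minus_node_mult[OF assms]
    by (auto intro!: derivative_eq_intros simp: algebra_simps)
qed

lemma bounds_from_derivative_power_fact:
  fixes F F' :: "real \<Rightarrow> real"
  assumes "\<And>x. (F has_real_derivative F' x) (at x)" "F 0 = 0"
    and F': "\<And>x. x \<ge> 0 \<Longrightarrow> F' x \<in> {0..x ^ N / fact N}" and "t \<ge> 0"
  shows "F t \<in> {0..t ^ Suc N / fact (Suc N)}"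
proof -
  have "F 0 \<le> F t"
    using assms by (intro DERIV_nonneg_imp_nondecreasing[of 0 t F]) auto
  moreover have "0 ^ Suc N / fact (Suc N) - F 0 \<le> t ^ Suc N / fact (Suc N) - F t"
  proof (rule DERIV_nonneg_imp_nondecreasing[OF \<open>t \<ge> 0\<close>])
    fix x :: real assume "0 \<le> x"
    have "real (Suc N) * x ^ N / fact (Suc N) = x ^ N / fact N"
      by (simp add: fact_Suc del: of_nat_Suc)
    then have "((\<lambda>x. x ^ Suc N / fact (Suc N) - F x) has_real_derivative x ^ N / fact N - F' x) (at x)"
      using DERIV_cdivide[OF DERIV_pow[of "Suc N" x], of "fact (Suc N)"] assms(1)
      by (intro DERIV_diff) simp_all
    then show "\<exists>y. ((\<lambda>x. x ^ Suc N / fact (Suc N) - F x) has_real_derivative y) (at x) \<and> 0 \<le> y"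
      using F'[OF \<open>0 \<le> x\<close>] by (intro exI conjI) auto
  qed
  ultimately show ?thesis using \<open>F 0 = 0\<close> by simp
qed

lemma divided_difference_exp_bounds:
  fixes S :: "real set"
  assumes "finite S" "card S = Suc N" "t \<ge> 0"
  shows "divided_difference (\<lambda>x. exp (x * t)) S \<in> {0..t ^ N / fact N * exp (Max S * t)}"
  using assms
proof (induction N arbitrary: S t)
  case 0
  then obtain m where "S = {m}" by (metis One_nat_def card_1_singletonE)
  then show ?case by simp
next
  case (Suc N)
  define m where "m = Max S"
  have m: "m \<in> S" unfolding m_def using Suc.prems by (intro Max_in) auto
  have "divided_difference (\<lambda>x. exp (x * t)) S * exp (- m * t) \<in> {0..t ^ Suc N / fact (Suc N)}"
  proof (rule bounds_from_derivative_power_fact)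
    fix x :: real assume x: "x \<ge> 0"
    have card: "card (S - {m}) = Suc N" using Suc.prems m by simp
    then have "S - {m} \<noteq> {}" by (metis card.empty nat.distinct(1))
    then have "Max (S - {m}) \<le> m"
      unfolding m_def using Suc.prems by (intro Max_mono) auto
    then have "x ^ N / fact N * exp (Max (S - {m}) * x) \<le> x ^ N / fact N * exp (m * x)"
      using x by (intro mult_left_mono) (auto intro: mult_right_mono)
    then have "divided_difference (\<lambda>y. exp (y * x)) (S - {m}) \<in> {0..x ^ N / fact N * exp (m * x)}"
      using Suc.IH[OF _ card x] Suc.prems(1) by auto
    then show "divided_difference (\<lambda>y. exp (y * x)) (S - {m}) * exp (- m * x) \<in> {0..x ^ N / fact N}"
      by (simp add: exp_minus pos_divide_le_eq flip: divide_inverse)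
  qed (use Suc.prems has_real_derivative_divided_difference_exp[OF Suc.prems(1) m] in
      \<open>simp_all add: divided_difference_const\<close>)
  then show ?case
    by (simp add: m_def exp_minus pos_divide_le_eq zero_le_divide_iff flip: divide_inverse)
qed

section \<open>Diagonal Pade approximants of powers\<close>

text \<open>
  Up to sign and a common factor, \<open>pade_coeff \<alpha> r i\<close> are the weights of \<open>T\<^bsup>i + \<alpha>\<^esup>\<close> and of \<open>T\<^bsup>r - i\<^esup>\<close> in the
  divided difference of \<open>x \<mapsto> T\<^bsup>x\<^esup>\<close> at the nodes \<open>i\<close> and \<open>i + \<alpha>\<close>, \<open>i \<le> r\<close>.
\<close>

definition pade_coeff :: "'a::field_char_0 \<Rightarrow> nat \<Rightarrow> nat \<Rightarrow> 'a" where
  "pade_coeff \<alpha> r i = ((of_nat r + \<alpha>) gchoose (r - i)) * ((of_nat r - \<alpha>) gchoose i)"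

lemma pade_coeff_minus: "i \<le> r \<Longrightarrow> pade_coeff (- \<alpha>) r (r - i) = pade_coeff \<alpha> r i"
  by (simp add: pade_coeff_def mult.commute)

lemma sum_pade_coeff: "(\<Sum>i\<le>r. pade_coeff \<alpha> r i) = of_nat ((2 * r) choose r)"
proof -
  have "(\<Sum>i\<le>r. pade_coeff \<alpha> r i)
      = (\<Sum>i\<in>{0..r}. ((of_nat r - \<alpha>) gchoose i) * ((of_nat r + \<alpha>) gchoose (r - i)))"
    by (simp add: pade_coeff_def mult.commute atMost_atLeast0)
  also have "\<dots> = (of_nat r - \<alpha> + (of_nat r + \<alpha>)) gchoose r" by (rule gbinomial_Vandermonde)
  also have "of_nat r - \<alpha> + (of_nat r + \<alpha>) = of_nat (2 * r)" by simp
  finally show ?thesis by (simp only: binomial_gbinomial)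
qed

lemma gbinomial_pos:
  fixes x :: "'a::linordered_field"
  assumes "of_nat n < x + 1"
  shows "0 < x gchoose n"
  using assms by (simp add: gbinomial_pochhammer' pochhammer_pos algebra_simps)

lemma pade_coeff_pos:
  fixes \<alpha> :: "'a::linordered_field"
  assumes "\<bar>\<alpha>\<bar> < 1" "i \<le> r"
  shows "0 < pade_coeff \<alpha> r i"
  unfolding pade_coeff_def
proof (intro mult_pos_pos gbinomial_pos)
  have "of_nat (r - i) \<le> (of_nat r :: 'a)" by (simp only: of_nat_le_iff diff_le_self)
  then show "of_nat (r - i) < of_nat r + \<alpha> + 1" using assms(1) by linarith
  have "of_nat i \<le> (of_nat r :: 'a)" using assms(2) by (simp only: of_nat_le_iff)
  then show "of_nat i < of_nat r - \<alpha> + 1" using assms(1) by linarith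
qed

lemma prod_node_minus_nodes:
  fixes \<alpha> :: "'a::comm_ring_1"
  assumes "i \<le> r"
  shows "(\<Prod>j\<le>r. of_nat i + \<alpha> - of_nat j)
    = \<alpha> * pochhammer (1 + \<alpha>) i * (-1) ^ (r - i) * pochhammer (1 - \<alpha>) (r - i)"
proof -
  have "(\<Prod>j\<le>i + m. of_nat i + \<alpha> - of_nat j)
      = \<alpha> * pochhammer (1 + \<alpha>) i * (-1) ^ m * pochhammer (1 - \<alpha>) m" for m
  proof (induction m)
    case 0
    have "(\<Prod>j\<le>i. of_nat i + \<alpha> - of_nat j) = (\<Prod>j\<in>{0..i}. \<alpha> + of_nat (i - j))"
      by (intro prod.cong) (auto simp: of_nat_diff)
    also have "\<dots> = \<alpha> * pochhammer (1 + \<alpha>) i"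
      by (simp only: pochhammer_Suc_prod_rev[symmetric] pochhammer_rec add.commute[of \<alpha> 1])
    finally show ?case by simp
  next
    case (Suc m)
    then show ?case by (simp add: pochhammer_Suc algebra_simps)
  qed
  from this[of "r - i"] show ?thesis using assms by simp
qed

lemma prod_node_minus_other_nodes:
  assumes "i \<le> r"
  shows "(\<Prod>j\<in>{..r} - {i}. of_nat i - of_nat j :: 'a::{comm_ring_1,ring_char_0})
    = (-1) ^ (r - i) * fact i * fact (r - i)"
proof -
  have "(\<Prod>j\<in>{..i + m} - {i}. of_nat i - of_nat j :: 'a) = (-1) ^ m * fact i * fact m" for m
  proof (induction m)
    case 0
    have "(\<Prod>j\<in>{..i} - {i}. of_nat i - of_nat j :: 'a) = (\<Prod>j\<in>{0..<i}. of_nat (i - j))"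
      by (intro prod.cong) (auto simp: of_nat_diff)
    then show ?case by (simp add: fact_prod_rev)
  next
    case (Suc m)
    have "{..i + Suc m} - {i} = insert (i + Suc m) ({..i + m} - {i})" by auto
    then show ?case by (simp add: Suc.IH algebra_simps)
  qed
  from this[of "r - i"] show ?thesis using assms by simp
qed

lemma pade_coeff_mult_node_products:
  fixes \<alpha> :: "'a::field_char_0"
  assumes "i \<le> r"
  shows "pade_coeff \<alpha> r i
      * ((\<Prod>j\<le>r. of_nat i + \<alpha> - of_nat j) * (\<Prod>j\<in>{..r} - {i}. of_nat i - of_nat j))
    = \<alpha> * pochhammer (1 + \<alpha>) r * pochhammer (1 - \<alpha>) r"
proof -
  have "of_nat r + \<alpha> - of_nat (r - i) + 1 = 1 + \<alpha> + of_nat i"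
    "of_nat r - \<alpha> - of_nat i + 1 = 1 - \<alpha> + of_nat (r - i)"
    using assms by (simp_all add: of_nat_diff)
  then have "pade_coeff \<alpha> r i * (fact i * fact (r - i))
      = pochhammer (1 + \<alpha> + of_nat i) (r - i) * pochhammer (1 - \<alpha> + of_nat (r - i)) i"
    by (simp only: pade_coeff_def gbinomial_pochhammer') simp
  then have "pade_coeff \<alpha> r i
        * ((\<Prod>j\<le>r. of_nat i + \<alpha> - of_nat j) * (\<Prod>j\<in>{..r} - {i}. of_nat i - of_nat j))
      = \<alpha> * (pochhammer (1 + \<alpha>) i * pochhammer (1 + \<alpha> + of_nat i) (r - i))
          * (pochhammer (1 - \<alpha>) (r - i) * pochhammer (1 - \<alpha> + of_nat (r - i)) i)"
    unfolding prod_node_minus_nodes[OF assms] prod_node_minus_other_nodes[OF assms]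
    by (simp add: algebra_simps flip: power_add mult_2)
  also have "pochhammer (1 + \<alpha>) i * pochhammer (1 + \<alpha> + of_nat i) (r - i) = pochhammer (1 + \<alpha>) r"
    using pochhammer_product[of i r "1 + \<alpha>"] assms by simp
  also have "pochhammer (1 - \<alpha>) (r - i) * pochhammer (1 - \<alpha> + of_nat (r - i)) i = pochhammer (1 - \<alpha>) r"
    using pochhammer_product[of "r - i" r "1 - \<alpha>"] assms by simp
  finally show ?thesis .
qed

definition pade_hom :: "'a::field_char_0 \<Rightarrow> nat \<Rightarrow> 'a \<Rightarrow> 'a \<Rightarrow> 'a" where
  "pade_hom \<alpha> r u v = (\<Sum>i\<le>r. pade_coeff \<alpha> r i * u ^ i * v ^ (r - i))"

lemma pade_hom_scale: "pade_hom \<alpha> r (c * u) (c * v) = c ^ r * pade_hom \<alpha> r u v"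
  unfolding pade_hom_def sum_distrib_left
proof (rule sum.cong[OF refl])
  fix i assume "i \<in> {..r}"
  then have "c ^ r = c ^ i * c ^ (r - i)" by (simp flip: power_add)
  then show "pade_coeff \<alpha> r i * (c * u) ^ i * (c * v) ^ (r - i)
      = c ^ r * (pade_coeff \<alpha> r i * u ^ i * v ^ (r - i))"
    by (simp add: power_mult_distrib mult_ac)
qed

lemma pade_hom_one_left: "pade_hom \<alpha> r 1 u = (\<Sum>i\<le>r. pade_coeff \<alpha> r (r - i) * u ^ i)"
  using sum.atLeastAtMost_rev[of "\<lambda>i. pade_coeff \<alpha> r i * u ^ (r - i)" 0 r]
  by (simp add: pade_hom_def atMost_atLeast0)

definition pade_remainder :: "real \<Rightarrow> nat \<Rightarrow> real \<Rightarrow> real" where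
  "pade_remainder \<alpha> r T = T powr \<alpha> * pade_hom \<alpha> r T 1 - pade_hom \<alpha> r 1 T"

lemma pade_hom_bounds:
  fixes \<alpha> u v h :: real
  assumes "\<bar>\<alpha>\<bar> < 1" "u \<in> {0..h}" "v \<in> {0..h}"
  shows "pade_hom \<alpha> r u v \<in> {0..(4 * h) ^ r}"
proof -
  have coeff: "0 \<le> pade_coeff \<alpha> r i" if "i \<le> r" for i
    using pade_coeff_pos[OF assms(1) that] by simp
  have "0 \<le> pade_hom \<alpha> r u v"
    unfolding pade_hom_def using assms coeff by (intro sum_nonneg mult_nonneg_nonneg) auto
  moreover have "pade_hom \<alpha> r u v \<le> (\<Sum>i\<le>r. pade_coeff \<alpha> r i) * h ^ r"
    unfolding pade_hom_def sum_distrib_right mult.assoc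
  proof (intro sum_mono mult_left_mono)
    fix i assume i: "i \<in> {..r}"
    have "u ^ i * v ^ (r - i) \<le> h ^ i * h ^ (r - i)"
      using assms by (intro mult_mono power_mono) auto
    then show "u ^ i * v ^ (r - i) \<le> h ^ r" using i by (simp flip: power_add)
  qed (use coeff in simp)
  moreover have "(\<Sum>i\<le>r. pade_coeff \<alpha> r i) * h ^ r \<le> (4 * h) ^ r"
  proof -
    have "real ((2 * r) choose r) \<le> real (2 ^ (2 * r))"
      by (simp only: of_nat_le_iff binomial_le_pow2)
    then show ?thesis
      using assms(2) by (simp add: sum_pade_coeff power_mult_distrib power_mult mult_right_mono)
  qed
  ultimately show ?thesis by simp
qed

lemma power_mult_pade_coeff_Ints:
  fixes k :: nat
  assumes "k > 0" "i \<le> r"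
  shows "of_nat k ^ (2 * r) * pade_coeff (1 / of_nat k :: 'a::field_char_0) r i \<in> \<int>"
proof -
  have "of_nat k ^ (2 * r) = (of_nat k ^ (2 * (r - i)) * of_nat k ^ (2 * i) :: 'a)"
    using assms(2) by (simp flip: power_add add_mult_distrib2)
  moreover have "of_nat r + 1 / of_nat k = (of_int (int r * int k + 1) / of_int (int k) :: 'a)"
    "of_nat r - 1 / of_nat k = (of_int (int r * int k - 1) / of_int (int k) :: 'a)"
    using assms(1) by (simp_all add: field_simps)
  ultimately have "of_nat k ^ (2 * r) * pade_coeff (1 / of_nat k :: 'a) r i
      = (of_int (int k) ^ (2 * (r - i)) * ((of_int (int r * int k + 1) / of_int (int k)) gchoose (r - i)))
      * (of_int (int k) ^ (2 * i) * ((of_int (int r * int k - 1) / of_int (int k)) gchoose i))"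
    by (simp add: pade_coeff_def mult_ac)
  also have "\<dots> \<in> \<int>" using assms(1) by (intro Ints_mult power_mult_gbinomial_Ints) simp_all
  finally show ?thesis .
qed

lemma power_mult_pade_hom_Ints:
  assumes "k > 0" "u \<in> \<int>" "v \<in> \<int>"
  shows "of_nat k ^ (2 * r) * pade_hom (1 / of_nat k :: 'a::field_char_0) r u v \<in> \<int>"
  unfolding pade_hom_def sum_distrib_left mult.assoc[symmetric] using assms
  by (intro Ints_sum Ints_mult[OF Ints_mult] power_mult_pade_coeff_Ints Ints_power) auto

definition pade_nodes :: "real \<Rightarrow> nat \<Rightarrow> real set" where
  "pade_nodes \<alpha> r = real ` {..r} \<union> (\<lambda>i. real i + \<alpha>) ` {..r}"

lemma finite_pade_nodes: "finite (pade_nodes \<alpha> r)"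
  by (simp add: pade_nodes_def)

lemma pade_nodes_disjoint:
  assumes "0 < \<alpha>" "\<alpha> < 1"
  shows "real ` {..r} \<inter> (\<lambda>i. real i + \<alpha>) ` {..r} = {}"
proof -
  have "real i \<noteq> real j + \<alpha>" for i j
  proof
    assume "real i = real j + \<alpha>"
    then have "real j < real i" "real i < real (Suc j)" using assms by simp_all
    then show False by simp
  qed
  then show ?thesis by blast
qed

lemma card_pade_nodes:
  assumes "0 < \<alpha>" "\<alpha> < 1"
  shows "card (pade_nodes \<alpha> r) = Suc (2 * r + 1)"
proof -
  have "card (pade_nodes \<alpha> r) = card (real ` {..r}) + card ((\<lambda>i. real i + \<alpha>) ` {..r})"
    unfolding pade_nodes_def by (intro card_Un_disjoint pade_nodes_disjoint assms) auto
  then show ?thesis by (simp add: card_image inj_on_def)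
qed

lemma Max_pade_nodes:
  assumes "0 \<le> \<alpha>"
  shows "Max (pade_nodes \<alpha> r) = real r + \<alpha>"
  using assms by (intro Max_eqI) (auto simp: pade_nodes_def add_increasing2)

lemma prod_diff_pade_nodes:
  assumes "0 < \<alpha>" "\<alpha> < 1" "i \<le> r"
  shows "(\<Prod>y\<in>pade_nodes \<alpha> r - {real i}. real i - y)
      = (\<Prod>j\<le>r. real i + - \<alpha> - real j) * (\<Prod>j\<in>{..r} - {i}. real i - real j)"
    and "(\<Prod>y\<in>pade_nodes \<alpha> r - {real i + \<alpha>}. real i + \<alpha> - y)
      = (\<Prod>j\<le>r. real i + \<alpha> - real j) * (\<Prod>j\<in>{..r} - {i}. real i - real j)"
proof -
  let ?f = "\<lambda>i. real i + \<alpha>"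
  note disjoint = pade_nodes_disjoint[OF assms(1,2), of r]
  have "pade_nodes \<alpha> r - {real i} = ?f ` {..r} \<union> real ` ({..r} - {i})"
    "pade_nodes \<alpha> r - {?f i} = real ` {..r} \<union> ?f ` ({..r} - {i})"
    using disjoint assms(3) unfolding pade_nodes_def by auto
  moreover have "?f ` {..r} \<inter> real ` ({..r} - {i}) = {}" "real ` {..r} \<inter> ?f ` ({..r} - {i}) = {}"
    using disjoint by auto
  ultimately show "(\<Prod>y\<in>pade_nodes \<alpha> r - {real i}. real i - y)
      = (\<Prod>j\<le>r. real i + - \<alpha> - real j) * (\<Prod>j\<in>{..r} - {i}. real i - real j)"
    "(\<Prod>y\<in>pade_nodes \<alpha> r - {?f i}. ?f i - y)
      = (\<Prod>j\<le>r. real i + \<alpha> - real j) * (\<Prod>j\<in>{..r} - {i}. real i - real j)"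
    by (simp_all add: prod.union_disjoint prod.reindex inj_on_def algebra_simps)
qed

lemma pade_remainder_eq_divided_difference:
  assumes "0 < \<alpha>" "\<alpha> < 1" "T > 0"
  shows "pade_remainder \<alpha> r T = \<alpha> * pochhammer (1 + \<alpha>) r * pochhammer (1 - \<alpha>) r
    * divided_difference (\<lambda>x. exp (x * ln T)) (pade_nodes \<alpha> r)"
proof -
  define c where "c = \<alpha> * pochhammer (1 + \<alpha>) r * pochhammer (1 - \<alpha>) r"
  define w where "w x = (\<Prod>y\<in>pade_nodes \<alpha> r - {x}. x - y)" for x
  have "c \<noteq> 0" using assms by (simp add: c_def pochhammer_pos less_imp_neq[THEN not_sym])
  have weights: "c / w (real i) = - pade_coeff \<alpha> r (r - i)" "c / w (real i + \<alpha>) = pade_coeff \<alpha> r i"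
    if "i \<le> r" for i
  proof -
    have "pade_coeff \<alpha> r (r - i) * w (real i) = - c"
      using pade_coeff_mult_node_products[OF that, of "- \<alpha>"] pade_coeff_minus[of "r - i" r \<alpha>] that
      by (simp add: w_def prod_diff_pade_nodes[OF assms(1,2)] c_def mult_ac)
    moreover from this have "w (real i) \<noteq> 0" using \<open>c \<noteq> 0\<close> by auto
    ultimately show "c / w (real i) = - pade_coeff \<alpha> r (r - i)" by (simp add: nonzero_divide_eq_eq)
    have "pade_coeff \<alpha> r i * w (real i + \<alpha>) = c"
      using pade_coeff_mult_node_products[OF that, of \<alpha>]
      by (simp add: w_def prod_diff_pade_nodes[OF assms(1,2) that] c_def)
    moreover from this have "w (real i + \<alpha>) \<noteq> 0" using \<open>c \<noteq> 0\<close> by auto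
    ultimately show "c / w (real i + \<alpha>) = pade_coeff \<alpha> r i" by (simp add: nonzero_divide_eq_eq)
  qed
  have exp_ln: "exp (x * ln T) = T powr x" for x using assms(3) by (simp add: powr_def)
  have "c * divided_difference (\<lambda>x. exp (x * ln T)) (pade_nodes \<alpha> r)
      = (\<Sum>x\<in>pade_nodes \<alpha> r. T powr x * (c / w x))"
    unfolding divided_difference_def sum_distrib_left by (simp add: w_def exp_ln mult_ac)
  also have "\<dots> = (\<Sum>i\<le>r. T powr real i * (c / w (real i)))
      + (\<Sum>i\<le>r. T powr (real i + \<alpha>) * (c / w (real i + \<alpha>)))"
    using pade_nodes_disjoint[OF assms(1,2), of r] unfolding pade_nodes_def
    by (simp add: sum.union_disjoint sum.reindex inj_on_def)
  also have "(\<Sum>i\<le>r. T powr real i * (c / w (real i))) = - pade_hom \<alpha> r 1 T"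
    unfolding pade_hom_one_left sum_negf[symmetric] using assms(3)
    by (intro sum.cong refl) (simp add: weights(1) powr_realpow mult.commute)
  also have "(\<Sum>i\<le>r. T powr (real i + \<alpha>) * (c / w (real i + \<alpha>))) = T powr \<alpha> * pade_hom \<alpha> r T 1"
    unfolding pade_hom_def sum_distrib_left using assms(3)
    by (intro sum.cong refl) (simp add: weights(2) powr_realpow powr_add mult_ac)
  finally show ?thesis by (simp add: c_def pade_remainder_def)
qed

lemma pochhammer_mult_le_fact_power2:
  fixes \<alpha> :: "'a::linordered_field"
  assumes "\<bar>\<alpha>\<bar> < 1"
  shows "pochhammer (1 + \<alpha>) r * pochhammer (1 - \<alpha>) r \<le> fact r ^ 2"
proof (induction r)
  case (Suc r)
  have "pochhammer (1 + \<alpha>) (Suc r) * pochhammer (1 - \<alpha>) (Suc r)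
      = (pochhammer (1 + \<alpha>) r * pochhammer (1 - \<alpha>) r) * (of_nat (Suc r) ^ 2 - \<alpha> ^ 2)"
    by (simp add: pochhammer_Suc power2_eq_square algebra_simps)
  also have "\<dots> \<le> (pochhammer (1 + \<alpha>) r * pochhammer (1 - \<alpha>) r) * of_nat (Suc r) ^ 2"
    using assms by (intro mult_left_mono mult_nonneg_nonneg pochhammer_nonneg) auto
  also have "\<dots> \<le> fact r ^ 2 * of_nat (Suc r) ^ 2"
    by (intro mult_right_mono Suc.IH) simp
  finally show ?case by (simp add: power_mult_distrib mult.commute)
qed simp

lemma four_power_mult_fact_power2_le: "4 ^ r * fact r ^ 2 \<le> (fact (2 * r + 1) :: real)"
proof (cases "r = 0")
  case False
  then have "4 ^ r \<le> 2 * real r * real ((2 * r) choose r)"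
    using central_binomial_lower_bound[of r] by (simp add: divide_le_eq mult.commute)
  also have "\<dots> \<le> real (2 * r + 1) * real ((2 * r) choose r)"
    by (intro mult_right_mono) simp_all
  finally have "4 ^ r * fact r ^ 2 \<le> real (2 * r + 1) * real ((2 * r) choose r) * fact r ^ 2"
    by (intro mult_right_mono) simp_all
  also have "\<dots> = fact (2 * r + 1)" by (simp add: binomial_fact power2_eq_square)
  finally show ?thesis .
qed simp

lemma pade_remainder_bounds:
  assumes "0 < \<alpha>" "\<alpha> < 1" "T \<ge> 1"
  shows "pade_remainder \<alpha> r T \<in> {0..\<alpha> * ln T ^ (2 * r + 1) / 4 ^ r * T powr (real r + \<alpha>)}"
proof -
  define p where "p = pochhammer (1 + \<alpha>) r * pochhammer (1 - \<alpha>) r"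
  define d where "d = divided_difference (\<lambda>x. exp (x * ln T)) (pade_nodes \<alpha> r)"
  define L where "L = ln T ^ (2 * r + 1)"
  have remainder: "pade_remainder \<alpha> r T = \<alpha> * p * d"
    using pade_remainder_eq_divided_difference[OF assms(1,2), of T r] assms(3)
    by (simp add: p_def d_def mult.assoc)
  have "d \<in> {0..L / fact (2 * r + 1) * exp (Max (pade_nodes \<alpha> r) * ln T)}"
    unfolding d_def L_def using assms
    by (intro divided_difference_exp_bounds finite_pade_nodes card_pade_nodes) auto
  then have d_bounds: "0 \<le> d" "d \<le> L / fact (2 * r + 1) * T powr (real r + \<alpha>)"
    using assms by (simp_all add: Max_pade_nodes powr_def)
  have "0 \<le> L" using assms(3) by (simp add: L_def)
  have "0 \<le> p" using assms by (simp add: p_def pochhammer_nonneg)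
  have "p * 4 ^ r \<le> fact (2 * r + 1)"
  proof -
    have "p * 4 ^ r \<le> fact r ^ 2 * 4 ^ r"
      unfolding p_def using assms by (intro mult_right_mono pochhammer_mult_le_fact_power2) auto
    also have "\<dots> \<le> fact (2 * r + 1)"
      using four_power_mult_fact_power2_le[of r] by (simp only: mult.commute)
    finally show ?thesis .
  qed
  then have "p / fact (2 * r + 1) \<le> 1 / 4 ^ r"
    by (simp only: pos_divide_le_eq fact_gt_zero) (simp add: field_simps)
  then have "p / fact (2 * r + 1) * (L * T powr (real r + \<alpha>)) \<le> 1 / 4 ^ r * (L * T powr (real r + \<alpha>))"
    using \<open>0 \<le> L\<close> by (intro mult_right_mono) simp_all
  moreover have "p * d \<le> p * (L / fact (2 * r + 1) * T powr (real r + \<alpha>))"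
    using d_bounds(2) \<open>0 \<le> p\<close> by (rule mult_left_mono)
  ultimately have "\<alpha> * (p * d) \<le> \<alpha> * (1 / 4 ^ r * (L * T powr (real r + \<alpha>)))"
    using assms(1) by (intro mult_left_mono) (simp_all del: fact_Suc)
  then show ?thesis
    unfolding remainder using d_bounds(1) \<open>0 \<le> p\<close> assms(1) by (simp add: L_def mult_ac)
qed

lemma abs_pade_hom_remainder_le:
  assumes "0 < \<alpha>" "\<alpha> < 1" "0 < l" "u \<in> {l..h}" "v \<in> {l..h}"
  shows "\<bar>u powr \<alpha> * pade_hom \<alpha> r u v - v powr \<alpha> * pade_hom \<alpha> r v u\<bar>
    \<le> \<alpha> * (\<bar>u - v\<bar> / l) ^ (2 * r + 1) / 4 ^ r * h powr (real r + \<alpha>)"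
  using assms(4,5)
proof (induction v u rule: linorder_wlog)
  case (le v u)
  define T where "T = u / v"
  have v: "0 < v" "u = v * T" and T: "1 \<le> T" using le assms(3) by (auto simp: T_def)
  have "pade_hom \<alpha> r u v = v ^ r * pade_hom \<alpha> r T 1"
    "pade_hom \<alpha> r v u = v ^ r * pade_hom \<alpha> r 1 T"
    using pade_hom_scale[of \<alpha> r v T 1] pade_hom_scale[of \<alpha> r v 1 T] by (simp_all add: v(2))
  moreover have "u powr \<alpha> = v powr \<alpha> * T powr \<alpha>" "v powr (real r + \<alpha>) = v ^ r * v powr \<alpha>"
    using v(1) by (simp_all add: v(2) powr_mult powr_add powr_realpow)
  ultimately have "u powr \<alpha> * pade_hom \<alpha> r u v - v powr \<alpha> * pade_hom \<alpha> r v u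
      = v powr (real r + \<alpha>) * pade_remainder \<alpha> r T"
    by (simp only: pade_remainder_def right_diff_distrib mult_ac)
  also have "\<bar>\<dots>\<bar>
      \<le> v powr (real r + \<alpha>) * (\<alpha> * ln T ^ (2 * r + 1) / 4 ^ r * T powr (real r + \<alpha>))"
    unfolding abs_mult using pade_remainder_bounds[OF assms(1,2) T, of r] by (intro mult_mono) auto
  also have "\<dots> = \<alpha> * ln T ^ (2 * r + 1) / 4 ^ r * u powr (real r + \<alpha>)"
    by (simp add: v powr_mult)
  also have "\<dots> \<le> \<alpha> * (\<bar>u - v\<bar> / l) ^ (2 * r + 1) / 4 ^ r * h powr (real r + \<alpha>)"
  proof (intro mult_mono divide_right_mono mult_left_mono power_mono powr_mono2)
    have "ln T \<le> T - 1" using T by (intro ln_le_minus_one) simp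
    also have "\<dots> = \<bar>u - v\<bar> / v" using le v(1) by (simp add: T_def diff_divide_distrib)
    also have "\<dots> \<le> \<bar>u - v\<bar> / l" using le assms(3) v by (intro divide_left_mono) auto
    finally show "ln T \<le> \<bar>u - v\<bar> / l" .
  qed (use assms le T in auto)
  finally show ?case .
qed (simp add: abs_minus_commute)

definition pade_num :: "'a::field_char_0 \<Rightarrow> nat \<Rightarrow> 'a poly" where
  "pade_num \<alpha> r = (\<Sum>i\<le>r. monom (pade_coeff \<alpha> r i) i)"

definition pade_den :: "'a::field_char_0 \<Rightarrow> nat \<Rightarrow> 'a poly" where
  "pade_den \<alpha> r = (\<Sum>i\<le>r. monom (pade_coeff \<alpha> r (r - i)) i)"

lemma poly_pade_num: "poly (pade_num \<alpha> r) T = pade_hom \<alpha> r T 1"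
  by (simp add: pade_num_def pade_hom_def poly_sum poly_monom)

lemma poly_pade_den: "poly (pade_den \<alpha> r) T = pade_hom \<alpha> r 1 T"
  by (simp add: pade_den_def pade_hom_one_left poly_sum poly_monom)

lemma degree_pade_le: "degree (pade_num \<alpha> r) \<le> r" "degree (pade_den \<alpha> r) \<le> r"
  unfolding pade_num_def pade_den_def
  by (intro degree_sum_le; force intro: order_trans[OF degree_monom_le])+

lemma linear_power_dvd_if_poly_bigo:
  fixes p :: "real poly"
  assumes "poly p \<in> O[at_right a](\<lambda>x. (x - a) ^ m)"
  shows "[:- a, 1:] ^ m dvd p"
  using assms
proof (induction m arbitrary: p)
  case (Suc m)
  have "((\<lambda>x. (x - a) ^ Suc m) \<longlongrightarrow> (a - a) ^ Suc m) (at_right a)" by (intro tendsto_intros)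
  then have "(\<lambda>x. (x - a) ^ Suc m) \<in> o[at_right a](\<lambda>_. 1)" by (intro smalloI_tendsto) simp_all
  then have "poly p \<in> o[at_right a](\<lambda>_. 1)"
    using Suc.prems by (rule landau_o.big_small_trans[rotated])
  then have "(poly p \<longlongrightarrow> 0) (at_right a)" using smalloD_tendsto by fastforce
  moreover have "(poly p \<longlongrightarrow> poly p a) (at_right a)" by (intro tendsto_intros)
  ultimately have "poly p a = 0" by (intro tendsto_unique[of "at_right a" "poly p"]) auto
  then obtain q where q: "p = [:- a, 1:] * q" by (auto simp: poly_eq_0_iff_dvd)
  obtain c where "eventually (\<lambda>x. norm (poly p x) \<le> c * norm ((x - a) ^ Suc m)) (at_right a)"
    using Suc.prems by (elim landau_o.bigE)
  then have "eventually (\<lambda>x. norm (poly q x) \<le> c * norm ((x - a) ^ m)) (at_right a)"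
    using eventually_at_right_less[of a]
  proof eventually_elim
    case (elim x)
    have "poly p x = (x - a) * poly q x" by (simp add: q algebra_simps)
    then have "(x - a) * \<bar>poly q x\<bar> \<le> (x - a) * (c * \<bar>(x - a) ^ m\<bar>)"
      using elim by (simp add: abs_mult mult_ac)
    then show ?case using elim by simp
  qed
  then have "[:- a, 1:] ^ m dvd q" by (intro Suc.IH bigoI)
  then show ?case unfolding q power_Suc by (intro mult_dvd_mono) auto
qed simp

lemma poly_nonzero_if_linear_power_dvd:
  fixes p :: "'a::idom poly"
  assumes "[:- a, 1:] ^ n dvd p" "degree p \<le> n" "p \<noteq> 0" "x \<noteq> a"
  shows "poly p x \<noteq> 0"
proof -
  obtain q where q: "p = [:- a, 1:] ^ n * q" using assms(1) by (elim dvdE)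
  have "q \<noteq> 0" using q assms(3) by auto
  then have "degree p = n + degree q"
    unfolding q by (subst degree_mult_eq) (simp_all add: degree_power_eq)
  then have "degree q = 0" using assms(2) by simp
  then obtain c where "q = [:c:]" by (rule degree_eq_zeroE)
  with \<open>q \<noteq> 0\<close> show ?thesis using assms(4) by (auto simp: q)
qed

lemma pade_remainder_bigo:
  fixes \<alpha> :: real
  assumes "0 < \<alpha>" "\<alpha> < 1" "r \<le> s"
  shows "pade_remainder \<alpha> s \<in> O[at_right 1](\<lambda>T. (T - 1) ^ (2 * r + 1))"
proof (rule bigoI)
  have "eventually (\<lambda>T. T \<in> {1<..<2}) (at_right (1::real))" by (rule eventually_at_right_real) simp
  then show "eventually (\<lambda>T. norm (pade_remainder \<alpha> s T)
      \<le> \<alpha> / 4 ^ s * 2 powr (real s + \<alpha>) * norm ((T - 1) ^ (2 * r + 1))) (at_right 1)"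
  proof eventually_elim
    case (elim T)
    then have "norm (pade_remainder \<alpha> s T)
        \<le> \<alpha> * ln T ^ (2 * s + 1) / 4 ^ s * T powr (real s + \<alpha>)"
      using pade_remainder_bounds[OF assms(1,2), of T s] by auto
    also have "\<dots> \<le> \<alpha> * (T - 1) ^ (2 * r + 1) / 4 ^ s * 2 powr (real s + \<alpha>)"
    proof (intro mult_mono divide_right_mono mult_left_mono powr_mono2)
      have "ln T ^ (2 * s + 1) \<le> (T - 1) ^ (2 * s + 1)"
        using elim ln_le_minus_one[of T] by (intro power_mono) auto
      also have "\<dots> \<le> (T - 1) ^ (2 * r + 1)" using elim assms by (intro power_decreasing) auto
      finally show "ln T ^ (2 * s + 1) \<le> (T - 1) ^ (2 * r + 1)" .
    qed (use elim assms in auto)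
    finally show ?case using elim by (simp add: mult_ac)
  qed
qed

definition pade_determinant :: "'a::field_char_0 \<Rightarrow> nat \<Rightarrow> 'a poly" where
  "pade_determinant \<alpha> r = pade_num \<alpha> r * pade_den \<alpha> (Suc r) - pade_den \<alpha> r * pade_num \<alpha> (Suc r)"

lemma poly_pade_determinant:
  "poly (pade_determinant \<alpha> r) T
    = pade_hom \<alpha> r T 1 * pade_hom \<alpha> (Suc r) 1 T - pade_hom \<alpha> r 1 T * pade_hom \<alpha> (Suc r) T 1"
  by (simp add: pade_determinant_def poly_pade_num poly_pade_den)

lemma degree_pade_determinant_le: "degree (pade_determinant \<alpha> r) \<le> 2 * r + 1"
  unfolding pade_determinant_def using degree_pade_le[of \<alpha> r] degree_pade_le[of \<alpha> "Suc r"]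
  by (intro degree_diff_le order_trans[OF degree_mult_le]) auto

lemma linear_power_dvd_pade_determinant:
  fixes \<alpha> :: real
  assumes "0 < \<alpha>" "\<alpha> < 1"
  shows "[:- 1, 1:] ^ (2 * r + 1) dvd pade_determinant \<alpha> r"
proof (rule linear_power_dvd_if_poly_bigo)
  have poly_bounded: "poly p \<in> O[at_right 1](\<lambda>_. 1)" for p :: "real poly"
    by (rule bigoI_tendsto[where c = "poly p 1"]) (auto intro!: tendsto_eq_intros)
  let ?f = "\<lambda>T. pade_remainder \<alpha> r T * poly (pade_num \<alpha> (Suc r)) T
    - pade_remainder \<alpha> (Suc r) T * poly (pade_num \<alpha> r) T"
  have "?f \<in> O[at_right 1](\<lambda>T. (T - 1) ^ (2 * r + 1) * 1)"
    using assms by (intro sum_in_bigo landau_o.big_mult pade_remainder_bigo poly_bounded) auto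
  also have "?f = poly (pade_determinant \<alpha> r)"
    unfolding poly_pade_determinant fun_eq_iff
    by (simp add: pade_remainder_def poly_pade_num algebra_simps)
  finally show "poly (pade_determinant \<alpha> r) \<in> O[at_right 1](\<lambda>T. (T - 1) ^ (2 * r + 1))" by simp
qed

lemma poly_pade_determinant_0:
  "poly (pade_determinant \<alpha> r) 0
    = ((of_nat r + \<alpha>) gchoose r) * ((of_nat r - \<alpha>) gchoose r) * (- 2 * \<alpha> / of_nat (Suc r))"
proof -
  have pade_hom_0: "pade_hom \<alpha> s 0 1 = (of_nat s + \<alpha>) gchoose s"
    "pade_hom \<alpha> s 1 0 = (of_nat s - \<alpha>) gchoose s" for s
    by (simp add: pade_hom_def pade_coeff_def) (simp add: pade_hom_one_left pade_coeff_def)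
  have gchoose_Suc:
    "(of_nat (Suc r) + \<alpha>) gchoose Suc r
      = ((of_nat r + \<alpha>) gchoose r) * (of_nat r + \<alpha> + 1) / of_nat (Suc r)"
    "(of_nat (Suc r) - \<alpha>) gchoose Suc r
      = ((of_nat r - \<alpha>) gchoose r) * (of_nat r - \<alpha> + 1) / of_nat (Suc r)"
    using gbinomial_rec[of "of_nat r + \<alpha>" r] gbinomial_rec[of "of_nat r - \<alpha>" r]
    by (simp_all add: add_ac add_diff_eq)
  show ?thesis
    unfolding poly_pade_determinant pade_hom_0 gchoose_Suc
    by (simp add: algebra_simps add_divide_distrib diff_divide_distrib)
qed

text \<open>
  The determinant is a polynomial of degree at most \<open>2r + 1\<close> that vanishes to order \<open>2r + 1\<close> at \<open>1\<close>
  but not at \<open>0\<close>.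
\<close>

lemma poly_pade_determinant_nonzero:
  fixes \<alpha> T :: real
  assumes "0 < \<alpha>" "\<alpha> < 1" "T \<noteq> 1"
  shows "poly (pade_determinant \<alpha> r) T \<noteq> 0"
proof (rule poly_nonzero_if_linear_power_dvd[of 1 "2 * r + 1"])
  have "0 < (real r + \<alpha>) gchoose r" "0 < (real r - \<alpha>) gchoose r"
    using assms by (auto intro!: gbinomial_pos)
  then have "poly (pade_determinant \<alpha> r) 0 \<noteq> 0" using assms(1) by (simp add: poly_pade_determinant_0)
  then show "pade_determinant \<alpha> r \<noteq> 0" by auto
qed (use assms in \<open>simp_all only: linear_power_dvd_pade_determinant degree_pade_determinant_le
    not_False_eq_True\<close>)

lemma pade_hom_determinant_nonzero:
  fixes \<alpha> u v :: real
  assumes "0 < \<alpha>" "\<alpha> < 1" "v \<noteq> 0" "u \<noteq> v"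
  shows "pade_hom \<alpha> r u v * pade_hom \<alpha> (Suc r) v u \<noteq> pade_hom \<alpha> r v u * pade_hom \<alpha> (Suc r) u v"
proof -
  have "pade_hom \<alpha> s u v = v ^ s * pade_hom \<alpha> s (u / v) 1"
    "pade_hom \<alpha> s v u = v ^ s * pade_hom \<alpha> s 1 (u / v)" for s
    using pade_hom_scale[of \<alpha> s v "u / v" 1] pade_hom_scale[of \<alpha> s v 1 "u / v"] assms(3) by simp_all
  then show ?thesis
    using poly_pade_determinant_nonzero[OF assms(1,2), of "u / v" r] assms(3,4)
    by (simp add: poly_pade_determinant mult_ac)
qed

section \<open>Comparing two solutions\<close>

lemma abs_powr_diff_le:
  fixes \<alpha> m x y :: real
  assumes "0 < \<alpha>" "\<alpha> \<le> 1" "0 < m" "m \<le> x" "m \<le> y"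
  shows "\<bar>x powr \<alpha> - y powr \<alpha>\<bar> \<le> \<alpha> * m powr (\<alpha> - 1) * \<bar>x - y\<bar>"
  using assms(4,5)
proof (induction x y rule: linorder_wlog)
  case (le x y)
  show ?case
  proof (cases "x = y")
    case False
    have "((\<lambda>x. x powr \<alpha>) has_real_derivative \<alpha> * z powr (\<alpha> - 1)) (at z)" if "x \<le> z" for z
      using that le assms(3) by (intro has_real_derivative_powr) simp
    then obtain z where mean_value: "x < z" "y powr \<alpha> - x powr \<alpha> = (y - x) * (\<alpha> * z powr (\<alpha> - 1))"
      using MVT2[of x y "\<lambda>x. x powr \<alpha>" "\<lambda>z. \<alpha> * z powr (\<alpha> - 1)"] le False by force
    have "z powr (\<alpha> - 1) \<le> m powr (\<alpha> - 1)" using mean_value le assms by (intro powr_mono2') auto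
    then have "(y - x) * (\<alpha> * z powr (\<alpha> - 1)) \<le> (y - x) * (\<alpha> * m powr (\<alpha> - 1))"
      using le assms(1) by (intro mult_left_mono) auto
    moreover have "0 \<le> (y - x) * (\<alpha> * z powr (\<alpha> - 1))" using le assms(1) by simp
    ultimately show ?thesis using mean_value le by (simp add: abs_minus_commute mult_ac)
  qed simp
qed (simp add: abs_minus_commute)

lemma powr_le_mult_powr:
  fixes \<alpha> D x :: real
  assumes "0 \<le> \<alpha>" "\<alpha> \<le> 1" "0 \<le> x" "x \<le> c * D" "1 \<le> c" "0 \<le> D"
  shows "x powr \<alpha> \<le> c * D powr \<alpha>"
proof -
  have "x powr \<alpha> \<le> c powr \<alpha> * D powr \<alpha>"
    using assms by (simp add: powr_mono2 flip: powr_mult)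
  also have "\<dots> \<le> c powr 1 * D powr \<alpha>" using assms by (intro mult_right_mono powr_mono) auto
  finally show ?thesis using assms by simp
qed

lemma abs_pade_hom_remainder_near_le:
  fixes \<alpha> \<delta> u v D :: real
  assumes "0 < \<alpha>" "\<alpha> < 1" "0 < D"
    and "u \<in> {15/16 * D..17/16 * D}" "v \<in> {15/16 * D..17/16 * D}" "\<bar>u - v\<bar> \<le> \<delta>"
  shows "\<bar>u powr \<alpha> * pade_hom \<alpha> r u v - v powr \<alpha> * pade_hom \<alpha> r v u\<bar>
    \<le> 17/15 * \<alpha> * \<delta> * (D powr \<alpha> * (\<delta>\<^sup>2 / D) ^ r / D)"
proof -
  have "\<bar>u powr \<alpha> * pade_hom \<alpha> r u v - v powr \<alpha> * pade_hom \<alpha> r v u\<bar>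
      \<le> \<alpha> * (\<bar>u - v\<bar> / (15/16 * D)) ^ (2 * r + 1) / 4 ^ r * (17/16 * D) powr (real r + \<alpha>)"
    using assms by (intro abs_pade_hom_remainder_le) auto
  also have "\<dots> \<le> \<alpha> * (\<delta> / (15/16 * D)) ^ (2 * r + 1) / 4 ^ r
      * ((17/16 * D) ^ r * (17/16 * D powr \<alpha>))"
  proof (intro mult_mono divide_right_mono mult_left_mono power_mono)
    show "(17/16 * D) powr (real r + \<alpha>) \<le> (17/16 * D) ^ r * (17/16 * D powr \<alpha>)"
      unfolding powr_add using assms by (intro mult_mono powr_le_mult_powr) (auto simp: powr_realpow)
  qed (use assms in auto)
  also have "\<dots> = 17/15 * \<alpha> * \<delta> * (D powr \<alpha> * (68/225 * (\<delta>\<^sup>2 / D)) ^ r / D)"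
  proof -
    have "z ^ (2 * r) / 4 ^ r * w ^ r = (z\<^sup>2 / 4 * w) ^ r" for z w :: real
      by (simp add: power_mult power_mult_distrib power_divide)
    then have "(\<delta> / (15/16 * D)) ^ (2 * r) / 4 ^ r * (17/16 * D) ^ r
        = ((\<delta> / (15/16 * D))\<^sup>2 / 4 * (17/16 * D)) ^ r" .
    also have "(\<delta> / (15/16 * D))\<^sup>2 / 4 * (17/16 * D) = 68/225 * (\<delta>\<^sup>2 / D)"
      using assms(3) by (simp add: power2_eq_square field_simps)
    finally have "(\<delta> / (15/16 * D)) ^ (2 * r) / 4 ^ r * (17/16 * D) ^ r
        = (68/225 * (\<delta>\<^sup>2 / D)) ^ r" .
    from this[symmetric] show ?thesis by (simp add: power_add mult_ac)
  qed
  also have "\<dots> \<le> 17/15 * \<alpha> * \<delta> * (D powr \<alpha> * (\<delta>\<^sup>2 / D) ^ r / D)"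
  proof (intro mult_left_mono divide_right_mono power_mono)
    show "68/225 * (\<delta>\<^sup>2 / D) \<le> \<delta>\<^sup>2 / D" using assms(3) by (intro mult_left_le_one_le) auto
  qed (use assms in auto)
  finally show ?thesis .
qed

lemma abs_pade_cross_difference_le:
  fixes \<alpha> \<delta> u v u' v' D D' :: real
  assumes \<alpha>: "0 < \<alpha>" "\<alpha> < 1" and D_pos: "0 < D" "0 < D'"
    and near: "u \<in> {15/16 * D..17/16 * D}" "v \<in> {15/16 * D..17/16 * D}" "\<bar>u - v\<bar> \<le> \<delta>"
    and near': "u' \<in> {15/16 * D'..17/16 * D'}" "v' \<in> {15/16 * D'..17/16 * D'}" "\<bar>u' - v'\<bar> \<le> \<delta>"
  shows "\<bar>u' powr \<alpha> * (v powr \<alpha> * pade_hom \<alpha> r v u)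
      - v' powr \<alpha> * (u powr \<alpha> * pade_hom \<alpha> r u v)\<bar>
    \<le> \<alpha> * \<delta> * (D * D') powr \<alpha> * (17/15 * ((5 * D) ^ r / D') + 289/240 * ((\<delta>\<^sup>2 / D) ^ r / D))"
proof -
  define R where "R = u powr \<alpha> * pade_hom \<alpha> r u v - v powr \<alpha> * pade_hom \<alpha> r v u"
  have "\<bar>(u' powr \<alpha> - v' powr \<alpha>) * (v powr \<alpha> * pade_hom \<alpha> r v u)\<bar>
      \<le> (\<alpha> * (16/15 * (D' powr \<alpha> / D')) * \<delta>) * ((17/16 * D powr \<alpha>) * (5 * D) ^ r)"
    unfolding abs_mult
  proof (intro mult_mono)
    have "(15/16 * D') powr (\<alpha> - 1) \<le> 16/15 * (D' powr \<alpha> / D')"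
      using powr_le_mult_powr[of \<alpha> "15/16 * D'" 1 D'] \<alpha> D_pos by (simp add: powr_diff field_simps)
    then show "\<bar>u' powr \<alpha> - v' powr \<alpha>\<bar> \<le> \<alpha> * (16/15 * (D' powr \<alpha> / D')) * \<delta>"
      using \<alpha> D_pos near' by (intro order_trans[OF abs_powr_diff_le[where m = "15/16 * D'"]] mult_mono) auto
    show "\<bar>v powr \<alpha>\<bar> \<le> 17/16 * D powr \<alpha>" using \<alpha> D_pos near powr_le_mult_powr[of \<alpha> v "17/16" D] by simp
    have "\<bar>pade_hom \<alpha> r v u\<bar> \<le> (4 * (17/16 * D)) ^ r"
      using pade_hom_bounds[of \<alpha> v "17/16 * D" u r] \<alpha> D_pos near by auto
    also have "\<dots> \<le> (5 * D) ^ r" using D_pos by (intro power_mono) auto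
    finally show "\<bar>pade_hom \<alpha> r v u\<bar> \<le> (5 * D) ^ r" .
  qed (use \<alpha> D_pos near in auto)
  also have "\<dots> = \<alpha> * \<delta> * (D * D') powr \<alpha> * (17/15 * ((5 * D) ^ r / D'))"
    by (simp add: powr_mult)
  finally have root_difference: "\<bar>(u' powr \<alpha> - v' powr \<alpha>) * (v powr \<alpha> * pade_hom \<alpha> r v u)\<bar> \<le> \<dots>" .
  have "\<bar>v' powr \<alpha> * R\<bar>
      \<le> (17/16 * D' powr \<alpha>) * (17/15 * \<alpha> * \<delta> * (D powr \<alpha> * (\<delta>\<^sup>2 / D) ^ r / D))"
    unfolding abs_mult R_def using \<alpha> D_pos near near' powr_le_mult_powr[of \<alpha> v' "17/16" D']
    by (intro mult_mono abs_pade_hom_remainder_near_le) auto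
  also have "\<dots> = \<alpha> * \<delta> * (D * D') powr \<alpha> * (289/240 * ((\<delta>\<^sup>2 / D) ^ r / D))"
    by (simp add: powr_mult)
  finally have remainder: "\<bar>v' powr \<alpha> * R\<bar> \<le> \<dots>" .
  have "u' powr \<alpha> * (v powr \<alpha> * pade_hom \<alpha> r v u) - v' powr \<alpha> * (u powr \<alpha> * pade_hom \<alpha> r u v)
      = (u' powr \<alpha> - v' powr \<alpha>) * (v powr \<alpha> * pade_hom \<alpha> r v u) - v' powr \<alpha> * R"
    by (simp add: R_def algebra_simps)
  then show ?thesis using root_difference remainder unfolding distrib_left by linarith
qed

definition shifted_power :: "nat \<Rightarrow> int \<Rightarrow> nat \<Rightarrow> nat \<Rightarrow> bool" where
  "shifted_power k n a b \<longleftrightarrow> 0 < a \<and> 0 < b \<and> (\<exists>x::nat. x \<ge> 1 \<and> int a * int b + n = int x ^ k)"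

lemma shifted_power_commute: "shifted_power k n a b \<longleftrightarrow> shifted_power k n b a"
  by (auto simp: shifted_power_def mult.commute)

definition shifted_root :: "nat \<Rightarrow> int \<Rightarrow> nat \<Rightarrow> nat \<Rightarrow> real" where
  "shifted_root k n a b = (real a * real b + real_of_int n) powr (1 / real k)"

lemma shifted_root:
  assumes "shifted_power k n a b" "k > 0"
  shows shifted_root_Nats: "shifted_root k n a b \<in> \<nat>"
    and shifted_root_pos: "0 < shifted_root k n a b"
    and shifted_root_power: "shifted_root k n a b ^ k = real a * real b + real_of_int n"
proof -
  obtain x :: nat where x: "x \<ge> 1" "int a * int b + n = int x ^ k"
    using assms(1) by (auto simp: shifted_power_def)
  have "real_of_int (int a * int b + n) = real_of_int (int x ^ k)" by (simp only: x)
  then have root: "real a * real b + real_of_int n = real x ^ k" by simp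
  then have "shifted_root k n a b = real x"
    using x(1) assms(2) by (simp add: shifted_root_def powr_powr flip: powr_realpow)
  then show "shifted_root k n a b \<in> \<nat>" "0 < shifted_root k n a b"
    "shifted_root k n a b ^ k = real a * real b + real_of_int n"
    using x(1) root by simp_all
qed

locale solution_rectangle =
  fixes k :: nat and n :: int and a a' b b' :: nat
  assumes k_ge_3: "k \<ge> 3" and n_nonzero: "n \<noteq> 0" and a_less: "a < a'" and b_less: "b < b'"
    and shifted_powers: "shifted_power k n a b" "shifted_power k n a b'"
      "shifted_power k n a' b" "shifted_power k n a' b'"
begin

abbreviation \<mu> :: real where "\<mu> \<equiv> ln \<bar>real_of_int n\<bar>"

lemma params_pos: "0 < k" "0 < a" "0 < a'" "0 < b" "0 < b'"
  using shifted_powers k_ge_3 by (auto simp: shifted_power_def)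

text \<open>
  The \<open>r\<close>-th approximant, cleared of denominators, is at most \<open>height\<^sup>r\<close>, and each step in \<open>r\<close> improves the
  approximation by the factor \<open>gain\<close>.
\<close>

definition height :: real where
  "height = 5 * real k ^ 2 * real a * real a' * real b"

definition gain :: real where
  "gain = real a * real b / (real k ^ 2 * (real_of_int n)\<^sup>2 * real a')"

definition product_root :: real where
  "product_root = (real a * real a' * real b * real b') powr (1 / real k)"

lemma height_pos: "0 < height" and gain_pos: "0 < gain" and product_root_pos: "0 < product_root"
  using params_pos n_nonzero by (simp_all add: height_def gain_def product_root_def)

lemma ln_height: "ln height = ln 5 + 2 * ln k + ln a + ln a' + ln b"
  using params_pos by (simp add: height_def ln_mult ln_realpow)

lemma ln_gain: "ln gain = ln a + ln b - ln a' - 2 * \<mu> - 2 * ln k"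
proof -
  define \<nu> where "\<nu> = \<bar>real_of_int n\<bar>"
  have "gain = real a * real b / (real k ^ 2 * \<nu>\<^sup>2 * real a')" by (simp add: gain_def \<nu>_def)
  moreover have "0 < \<nu>" "\<mu> = ln \<nu>" using n_nonzero by (simp_all add: \<nu>_def)
  ultimately show ?thesis using params_pos by (simp add: ln_mult ln_div ln_realpow)
qed

lemma ln_product_root: "real k * ln product_root = ln a + ln a' + ln b + ln b'"
  using params_pos by (simp add: product_root_def ln_powr ln_mult)

text \<open>
  Both values below are close to \<open>aa'c\<close>, and for \<open>c \<in> {b, b'}\<close> they are \<open>a'\<close> and \<open>a\<close> times a \<open>k\<close>-th power.
\<close>

definition lower_twist :: "nat \<Rightarrow> real" where
  "lower_twist c = real a' * (real a * real c + real_of_int n)"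

definition upper_twist :: "nat \<Rightarrow> real" where
  "upper_twist c = real a * (real a' * real c + real_of_int n)"

lemma twist_diff: "lower_twist c - upper_twist c = real_of_int n * (real a' - real a)"
  by (simp add: lower_twist_def upper_twist_def algebra_simps)

lemma abs_twist_diff_le: "\<bar>lower_twist c - upper_twist c\<bar> \<le> \<bar>real_of_int n\<bar> * real a'"
  unfolding twist_diff abs_mult using a_less by (intro mult_left_mono) auto

lemma twist_near:
  assumes "16 * \<bar>real_of_int n\<bar> \<le> real a * real c"
  defines "D \<equiv> real a * real a' * real c"
  shows "lower_twist c \<in> {15/16 * D..17/16 * D}" "upper_twist c \<in> {15/16 * D..17/16 * D}"
proof -
  have "16 * (\<bar>real_of_int n\<bar> * real a') \<le> D"
    using mult_right_mono[OF assms(1), of "real a'"] by (simp add: D_def mult_ac)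
  moreover have "\<bar>real_of_int n * real a'\<bar> \<le> \<bar>real_of_int n\<bar> * real a'"
    "\<bar>real_of_int n * real a\<bar> \<le> \<bar>real_of_int n\<bar> * real a'"
    using a_less by (auto simp: abs_mult intro!: mult_left_mono)
  moreover have "lower_twist c = D + real_of_int n * real a'" "upper_twist c = D + real_of_int n * real a"
    by (simp_all add: D_def lower_twist_def upper_twist_def algebra_simps)
  ultimately show "lower_twist c \<in> {15/16 * D..17/16 * D}" "upper_twist c \<in> {15/16 * D..17/16 * D}"
    by (auto simp: abs_le_iff)
qed

definition cross_difference :: "nat \<Rightarrow> real" where
  "cross_difference r =
    shifted_root k n a b' * shifted_root k n a' b
      * pade_hom (1 / real k) r (upper_twist b) (lower_twist b)
    - shifted_root k n a' b' * shifted_root k n a b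
      * pade_hom (1 / real k) r (lower_twist b) (upper_twist b)"

lemma cross_difference_eq:
  "(real a * real a') powr (1 / real k) * cross_difference r =
    lower_twist b' powr (1 / real k) *
      (upper_twist b powr (1 / real k) * pade_hom (1 / real k) r (upper_twist b) (lower_twist b))
    - upper_twist b' powr (1 / real k) *
      (lower_twist b powr (1 / real k) * pade_hom (1 / real k) r (lower_twist b) (upper_twist b))"
proof -
  have "lower_twist c powr (1 / real k) = real a' powr (1 / real k) * shifted_root k n a c"
    "upper_twist c powr (1 / real k) = real a powr (1 / real k) * shifted_root k n a' c" for c
    by (simp_all add: lower_twist_def upper_twist_def shifted_root_def powr_mult)
  then show ?thesis by (simp only: cross_difference_def powr_mult right_diff_distrib mult_ac)
qed

lemma height_gain_power:
  defines "D \<equiv> real a * real a' * real b"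
  shows "height ^ r = real k ^ (2 * r) * (5 * D) ^ r"
    and "(1 / gain) ^ r = real k ^ (2 * r) * ((\<bar>real_of_int n\<bar> * real a')\<^sup>2 / D) ^ r"
proof -
  have "height = real k ^ 2 * (5 * D)" by (simp add: height_def D_def)
  moreover have "1 / gain = real k ^ 2 * ((\<bar>real_of_int n\<bar> * real a')\<^sup>2 / D)"
    using params_pos by (simp add: gain_def D_def field_simps power2_eq_square)
  ultimately show "height ^ r = real k ^ (2 * r) * (5 * D) ^ r"
    "(1 / gain) ^ r = real k ^ (2 * r) * ((\<bar>real_of_int n\<bar> * real a')\<^sup>2 / D) ^ r"
    by (simp_all only: power_mult_distrib power_mult)
qed

lemma abs_cross_difference_le:
  assumes large: "16 * \<bar>real_of_int n\<bar> \<le> real a * real b"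
  shows "\<bar>real k ^ (2 * r) * cross_difference r\<bar>
    \<le> 1 / real k * (17/15 * (\<bar>real_of_int n\<bar> * product_root * height ^ r / (real a * real b'))
      + 289/240 * (\<bar>real_of_int n\<bar> * product_root / (real a * real b * gain ^ r)))" (is "_ \<le> ?bound")
proof -
  let ?\<alpha> = "1 / real k"
  define D where "D = real a * real a' * real b"
  define D' where "D' = real a * real a' * real b'"
  define \<delta> where "\<delta> = \<bar>real_of_int n\<bar> * real a'"
  define g where "g = (real a * real a') powr ?\<alpha>"
  have g_pos: "0 < g" using params_pos by (simp add: g_def)
  have large': "16 * \<bar>real_of_int n\<bar> \<le> real a * real b'"
    using b_less by (intro order_trans[OF large] mult_left_mono) auto
  have "g * \<bar>real k ^ (2 * r) * cross_difference r\<bar> = real k ^ (2 * r) * \<bar>g * cross_difference r\<bar>"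
    using g_pos by (simp add: abs_mult)
  also have "\<dots> \<le> real k ^ (2 * r) *
      (?\<alpha> * \<delta> * (D * D') powr ?\<alpha> * (17/15 * ((5 * D) ^ r / D') + 289/240 * ((\<delta>\<^sup>2 / D) ^ r / D)))"
    unfolding g_def cross_difference_eq D_def D'_def \<delta>_def
    using k_ge_3 params_pos twist_near[OF large] twist_near[OF large'] abs_twist_diff_le
    by (intro mult_left_mono abs_pade_cross_difference_le) simp_all
  also have "\<dots> = ?\<alpha> * \<delta> * (D * D') powr ?\<alpha>
      * (17/15 * (height ^ r / D') + 289/240 * ((1 / gain) ^ r / D))"
    unfolding height_gain_power D_def[symmetric] \<delta>_def[symmetric] by (simp add: algebra_simps)
  also have "(D * D') powr ?\<alpha> = g * product_root"
    by (simp add: D_def D'_def g_def product_root_def mult_ac flip: powr_mult)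
  also have "?\<alpha> * \<delta> * (g * product_root) * (17/15 * (height ^ r / D') + 289/240 * ((1 / gain) ^ r / D))
      = g * ?bound"
    using params_pos by (simp add: D_def D'_def \<delta>_def field_simps power_divide)
  finally show ?thesis using g_pos by (simp only: mult_le_cancel_left_pos)
qed

lemma abs_cross_difference_less_1:
  assumes "16 * \<bar>real_of_int n\<bar> \<le> real a * real b"
    and far: "\<bar>real_of_int n\<bar> * product_root * height ^ r \<le> real a * real b'"
    and approx: "\<bar>real_of_int n\<bar> * product_root \<le> real a * real b * gain ^ r"
  shows "\<bar>real k ^ (2 * r) * cross_difference r\<bar> < 1"
proof -
  note abs_cross_difference_le[OF assms(1), of r]
  also have "1 / real k * (17/15 * (\<bar>real_of_int n\<bar> * product_root * height ^ r / (real a * real b'))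
      + 289/240 * (\<bar>real_of_int n\<bar> * product_root / (real a * real b * gain ^ r)))
      \<le> 1 / 3 * (17/15 * 1 + 289/240 * 1)"
    using k_ge_3 far approx params_pos gain_pos height_pos product_root_pos
    by (intro mult_mono add_mono) (auto simp: divide_le_eq)
  also have "\<dots> < 1" by simp
  finally show ?thesis .
qed

lemma cross_difference_zero:
  assumes "16 * \<bar>real_of_int n\<bar> \<le> real a * real b"
    and "\<bar>real_of_int n\<bar> * product_root * height ^ r \<le> real a * real b'"
    and "\<bar>real_of_int n\<bar> * product_root \<le> real a * real b * gain ^ r"
  shows "cross_difference r = 0"
proof -
  note root_Ints = subsetD[OF Nats_subset_Ints shifted_root_Nats[OF _ params_pos(1)]]
  have twist_Ints: "lower_twist b \<in> \<int>" "upper_twist b \<in> \<int>"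
    by (simp_all add: lower_twist_def upper_twist_def)
  have "real k ^ (2 * r) * cross_difference r
      = shifted_root k n a b' * shifted_root k n a' b
          * (real k ^ (2 * r) * pade_hom (1 / real k) r (upper_twist b) (lower_twist b))
        - shifted_root k n a' b' * shifted_root k n a b
          * (real k ^ (2 * r) * pade_hom (1 / real k) r (lower_twist b) (upper_twist b))"
    by (simp add: cross_difference_def algebra_simps)
  also have "\<dots> \<in> \<int>"
    using shifted_powers twist_Ints params_pos(1)
    by (intro Ints_diff Ints_mult[OF Ints_mult] root_Ints power_mult_pade_hom_Ints)
  finally have "real k ^ (2 * r) * cross_difference r = 0"
    using abs_cross_difference_less_1[OF assms] by (rule Ints_nonzero_abs_less1)
  then show ?thesis using params_pos(1) by simp
qed

text \<open>
  If both vanished, the approximants of orders \<open>r\<close> and \<open>r + 1\<close> would take the same value at the quotient of the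
  twists, against the determinant.
\<close>

lemma cross_difference_Suc_nonzero:
  assumes "cross_difference r = 0"
  shows "cross_difference (Suc r) \<noteq> 0"
proof
  assume "cross_difference (Suc r) = 0"
  let ?\<alpha> = "1 / real k" and ?root = "shifted_root k n"
  let ?u = "lower_twist b" and ?v = "upper_twist b"
  define p where "p = ?root a b' * ?root a' b"
  define q where "q = ?root a' b' * ?root a b"
  have ratio: "p * pade_hom ?\<alpha> r ?v ?u = q * pade_hom ?\<alpha> r ?u ?v"
    "p * pade_hom ?\<alpha> (Suc r) ?v ?u = q * pade_hom ?\<alpha> (Suc r) ?u ?v"
    using assms \<open>cross_difference (Suc r) = 0\<close> by (simp_all add: cross_difference_def p_def q_def)
  have "p * q * (pade_hom ?\<alpha> r ?u ?v * pade_hom ?\<alpha> (Suc r) ?v ?u)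
      = (q * pade_hom ?\<alpha> r ?u ?v) * (p * pade_hom ?\<alpha> (Suc r) ?v ?u)"
    by (simp only: mult_ac)
  also have "\<dots> = (p * pade_hom ?\<alpha> r ?v ?u) * (q * pade_hom ?\<alpha> (Suc r) ?u ?v)"
    by (simp only: ratio)
  also have "\<dots> = p * q * (pade_hom ?\<alpha> r ?v ?u * pade_hom ?\<alpha> (Suc r) ?u ?v)"
    by (simp only: mult_ac)
  finally have "p * q * (pade_hom ?\<alpha> r ?u ?v * pade_hom ?\<alpha> (Suc r) ?v ?u)
      = p * q * (pade_hom ?\<alpha> r ?v ?u * pade_hom ?\<alpha> (Suc r) ?u ?v)" .
  moreover have "p \<noteq> 0" "q \<noteq> 0"
    using shifted_root_pos[OF _ params_pos(1)] shifted_powers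
    by (simp_all add: p_def q_def less_imp_neq[THEN not_sym])
  moreover have "?v \<noteq> 0"
  proof -
    have "0 < ?root a' b ^ k" using shifted_root_pos[OF shifted_powers(3) params_pos(1)] by simp
    then show ?thesis
      using params_pos shifted_root_power[OF shifted_powers(3) params_pos(1)] by (simp add: upper_twist_def)
  qed
  moreover have "?u \<noteq> ?v" using twist_diff[of b] n_nonzero a_less by auto
  ultimately show False
    using pade_hom_determinant_nonzero[of ?\<alpha> ?v ?u r] k_ge_3 by simp
qed

lemma cross_difference_zero_ln:
  assumes "ln 16 + \<mu> \<le> ln a + ln b"
    and "\<mu> + ln product_root + real r * ln height \<le> ln a + ln b'"
    and "\<mu> + ln product_root \<le> ln a + ln b + real r * ln gain"
  shows "cross_difference r = 0"
proof (rule cross_difference_zero)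
  have le_if_ln_le: "x \<le> y" if "ln x \<le> ln y" "0 < x" "0 < y" for x y :: real using that by simp
  have "0 < \<bar>real_of_int n\<bar>" using n_nonzero by simp
  note positive = this params_pos height_pos gain_pos product_root_pos
  show "16 * \<bar>real_of_int n\<bar> \<le> real a * real b"
    using assms(1) positive by - (rule le_if_ln_le, simp_all add: ln_mult)
  show "\<bar>real_of_int n\<bar> * product_root * height ^ r \<le> real a * real b'"
    using assms(2) positive by - (rule le_if_ln_le, simp_all add: ln_mult ln_realpow)
  show "\<bar>real_of_int n\<bar> * product_root \<le> real a * real b * gain ^ r"
    using assms(3) positive by - (rule le_if_ln_le, simp_all add: ln_mult ln_realpow)
qed

text \<open>
  The order \<open>r\<close> is the least one for which the approximants are good enough for the comparison;
  its minimality yields the lower bound for \<open>b'\<close> that the comparison also needs.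
\<close>

lemma no_far_solution:
  fixes r\<^sub>0 :: nat
  assumes large: "ln 16 + \<mu> \<le> ln a + ln b"
    and slope: "ln height \<le> (real k - 1) * ln gain"
    and base: "real k * \<mu> + ln a' + (real r\<^sub>0 + 1) * ln height
      \<le> (real k - 2) * (ln a + ln b) + (real k - 1) * ((real r\<^sub>0 - 1) * ln gain)"
    and far: "real k * (ln a + ln b + (real r\<^sub>0 - 1) * ln gain)
      < real k * \<mu> + ln a' + ln a + ln b + ln b'"
  shows False
proof -
  have ln_params_nonneg: "0 \<le> ln a" "0 \<le> ln a'" "0 \<le> ln b" "0 \<le> ln (real k)" using params_pos by auto
  have ln_height_pos: "0 < ln height"
    using ln_params_nonneg by (simp add: ln_height add_pos_nonneg add_nonneg_nonneg)
  then have "0 < (real k - 1) * ln gain" using slope by simp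
  then have ln_gain_pos: "0 < ln gain" using k_ge_3 by (simp add: zero_less_mult_iff)
  define t where "t = (\<mu> + ln product_root - ln a - ln b) / ln gain"
  have "real k * (ln a + ln b + (real r\<^sub>0 - 1) * ln gain) < real k * (\<mu> + ln product_root)"
    using far by (simp add: ln_product_root distrib_left)
  then have "ln a + ln b + (real r\<^sub>0 - 1) * ln gain < \<mu> + ln product_root" using params_pos by simp
  then have t_greater: "real r\<^sub>0 - 1 < t" using ln_gain_pos by (simp add: t_def pos_less_divide_eq)
  define r where "r = nat \<lceil>t\<rceil>"
  have r_bounds: "t \<le> real r" "real r - 1 < t" "r\<^sub>0 \<le> r" using t_greater unfolding r_def by linarith+
  have approx: "\<mu> + ln product_root \<le> ln a + ln b + real r * ln gain"
    and minimal: "ln a + ln b + (real r - 1) * ln gain < \<mu> + ln product_root"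
    using r_bounds(1,2) ln_gain_pos by (simp_all add: t_def pos_divide_le_eq pos_less_divide_eq)
  have b'_far: "\<mu> + ln product_root + real (Suc r) * ln height \<le> ln a + ln b'"
  proof -
    have "(real k - 1) * (ln a + ln b + (real r - 1) * ln gain - \<mu>) \<le> (real k - 1) * ln product_root"
      using minimal k_ge_3 by (intro mult_left_mono) auto
    moreover have "0 \<le> (real r - real r\<^sub>0) * ((real k - 1) * ln gain - ln height)"
      using r_bounds(3) slope by (intro mult_nonneg_nonneg) auto
    ultimately show ?thesis using base ln_product_root ln_params_nonneg(1) by (simp add: algebra_simps)
  qed
  have "cross_difference r = 0"
    using b'_far ln_height_pos by (intro cross_difference_zero_ln large approx) (simp add: algebra_simps)
  moreover have "cross_difference (Suc r) = 0"
    using approx ln_gain_pos by (intro cross_difference_zero_ln large b'_far) (simp add: algebra_simps)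
  ultimately show False using cross_difference_Suc_nonzero by blast
qed

lemma one_le_abs_root_product_diff:
  "1 \<le> \<bar>shifted_root k n a b' * shifted_root k n a' b - shifted_root k n a b * shifted_root k n a' b'\<bar>"
proof -
  let ?root = "shifted_root k n"
  have "(?root a b' * ?root a' b) ^ k - (?root a b * ?root a' b') ^ k
      = - real_of_int n * ((real a' - real a) * (real b' - real b))"
    using shifted_powers params_pos(1) by (simp add: power_mult_distrib shifted_root_power algebra_simps)
  moreover have "\<dots> \<noteq> 0" using n_nonzero a_less b_less by simp
  ultimately have "?root a b' * ?root a' b \<noteq> ?root a b * ?root a' b'" by auto
  moreover have "?root a b' * ?root a' b - ?root a b * ?root a' b' \<in> \<int>"
    using shifted_powers params_pos(1) subsetD[OF Nats_subset_Ints]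
    by (intro Ints_diff Ints_mult) (auto intro: shifted_root_Nats)
  ultimately show ?thesis by (intro Ints_nonzero_abs_ge1) auto
qed

lemma gap_principle_powr:
  assumes "4 * \<bar>real_of_int n\<bar> \<le> real a * real b"
  shows "1 \<le> 1 / real k * (9/16 * (real a * real a' * real b * real b')) powr (1 / real k - 1)
    * (\<bar>real_of_int n\<bar> * (real a' * real b'))"
proof -
  define P where "P = (real a * real b' + real_of_int n) * (real a' * real b + real_of_int n)"
  define Q where "Q = (real a * real b + real_of_int n) * (real a' * real b' + real_of_int n)"
  define m where "m = 9/16 * (real a * real a' * real b * real b')"
  have lower: "3/4 * (real c * real d) \<le> real c * real d + real_of_int n" if "a \<le> c" "b \<le> d" for c d
  proof -
    have "real a * real b \<le> real c * real d" using that by (intro mult_mono) auto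
    then have "4 * \<bar>real_of_int n\<bar> \<le> real c * real d" using assms by simp
    then show ?thesis by (simp add: abs_le_iff)
  qed
  have "(3/4 * (real a * real b')) * (3/4 * (real a' * real b)) \<le> P"
    unfolding P_def using a_less b_less by (intro mult_mono lower order_trans[OF _ lower]) auto
  moreover have "(3/4 * (real a * real b)) * (3/4 * (real a' * real b')) \<le> Q"
    unfolding Q_def using a_less b_less by (intro mult_mono lower order_trans[OF _ lower]) auto
  ultimately have m_le: "m \<le> P" "m \<le> Q" by (simp_all add: m_def mult_ac)
  have "1 \<le> \<bar>P powr (1 / real k) - Q powr (1 / real k)\<bar>"
    using one_le_abs_root_product_diff by (simp add: P_def Q_def shifted_root_def powr_mult)
  also have "\<dots> \<le> 1 / real k * m powr (1 / real k - 1) * \<bar>P - Q\<bar>"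
    using params_pos m_le by (intro abs_powr_diff_le) (simp_all add: m_def)
  also have "\<bar>P - Q\<bar> = \<bar>real_of_int n\<bar> * ((real a' - real a) * (real b' - real b))"
  proof -
    have "P - Q = - real_of_int n * ((real a' - real a) * (real b' - real b))"
      by (simp add: P_def Q_def algebra_simps)
    then show ?thesis using a_less b_less by (simp add: abs_mult)
  qed
  also have "1 / real k * m powr (1 / real k - 1) * \<dots>
      \<le> 1 / real k * m powr (1 / real k - 1) * (\<bar>real_of_int n\<bar> * (real a' * real b'))"
    using a_less b_less by (intro mult_left_mono mult_mono) auto
  finally show ?thesis by (simp add: m_def)
qed

lemma gap_principle:
  assumes "4 * \<bar>real_of_int n\<bar> \<le> real a * real b"
  shows "(real k - 1) * (ln a + ln b) \<le> real k * \<mu> + ln a' + ln b'"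
proof -
  define W where "W = ln (9/16) + (ln a + ln a' + ln b + ln b')"
  have "ln 1 \<le> ln (1 / real k * (9/16 * (real a * real a' * real b * real b')) powr (1 / real k - 1)
      * (\<bar>real_of_int n\<bar> * (real a' * real b')))"
    using gap_principle_powr[OF assms] params_pos n_nonzero by (subst ln_le_cancel_iff) auto
  also have "\<dots> = (1 / real k - 1) * W - ln k + \<mu> + ln a' + ln b'"
    using params_pos n_nonzero by (simp add: ln_mult ln_div ln_powr W_def)
  finally have "0 \<le> real k * ((1 / real k - 1) * W - ln k + \<mu> + ln a' + ln b')"
    using params_pos(1) by (intro mult_nonneg_nonneg) auto
  then have "(real k - 1) * W + real k * ln k \<le> real k * (\<mu> + ln a' + ln b')"
    using params_pos(1) by (simp add: algebra_simps)
  moreover have "0 \<le> (real k - 1) * ln (9/16) + real k * ln k"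
  proof -
    have "- ln (9/16) = ln (16/9 :: real)" by (simp add: ln_div)
    also have "\<dots> \<le> ln (real k)" using k_ge_3 by (subst ln_le_cancel_iff) auto
    finally have "(real k - 1) * - ln (9/16) \<le> (real k - 1) * ln k"
      using k_ge_3 by (intro mult_left_mono) auto
    moreover have "0 \<le> ln (real k)" using k_ge_3 by simp
    ultimately show ?thesis by (simp add: algebra_simps)
  qed
  ultimately show ?thesis by (simp add: W_def algebra_simps)
qed

end

section \<open>Growth along a grid of solutions\<close>

definition power_grid :: "nat \<Rightarrow> int \<Rightarrow> nat \<Rightarrow> (nat \<Rightarrow> nat) \<Rightarrow> (nat \<Rightarrow> nat) \<Rightarrow> bool" where
  "power_grid k n N a b \<longleftrightarrow>
     strict_mono_on {..<N} a \<and> strict_mono_on {..<N} b \<and> (\<forall>i<N. \<forall>j<N. shifted_power k n (a i) (b j))"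

lemma power_grid_commute: "power_grid k n N a b \<Longrightarrow> power_grid k n N b a"
  by (simp add: power_grid_def shifted_power_commute)

lemma power_grid_less:
  assumes "power_grid k n N a b" "i < j" "j < N"
  shows "a i < a j" "b i < b j"
  using assms by (auto simp: power_grid_def strict_mono_on_def)

lemma power_grid_shifted_power:
  "power_grid k n N a b \<Longrightarrow> i < N \<Longrightarrow> j < N \<Longrightarrow> shifted_power k n (a i) (b j)"
  by (simp add: power_grid_def)

lemma power_grid_pos:
  assumes "power_grid k n N a b" "i < N"
  shows "0 < a i" "0 < b i"
  using power_grid_shifted_power[OF assms(1) assms(2) assms(2)] by (auto simp: shifted_power_def)

definition corner_products :: "(nat \<Rightarrow> nat) \<Rightarrow> (nat \<Rightarrow> nat) \<Rightarrow> real set" where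
  "corner_products a b = {real (a 0) * real (b 1), real (a 1) * real (b 0)}"

lemma corner_products_commute: "corner_products a b = corner_products b a"
  by (auto simp: corner_products_def mult.commute)

locale large_power_grid =
  fixes k :: nat and n :: int and N :: nat and a b :: "nat \<Rightarrow> nat"
  assumes k_ge_3: "k \<ge> 3" and n_nonzero: "n \<noteq> 0" and grid: "power_grid k n N a b"
    and large: "\<And>p. p \<in> corner_products a b \<Longrightarrow> 4 * \<bar>real_of_int n\<bar> \<le> p"
begin

lemma large_power_grid_swap: "large_power_grid k n N b a"
  using k_ge_3 n_nonzero power_grid_commute[OF grid] large
  by unfold_locales (simp_all add: corner_products_commute)

abbreviation \<mu> :: real where "\<mu> \<equiv> ln \<bar>real_of_int n\<bar>"

definition level :: "nat \<Rightarrow> real" where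
  "level j = ln (a 0) + ln (b j)"

lemma level_1_corner_product: "1 < N \<Longrightarrow> \<exists>p\<in>corner_products a b. level 1 = ln p"
  using power_grid_pos[OF grid, of 0] power_grid_pos[OF grid, of 1]
  unfolding level_def corner_products_def by (simp add: ln_mult)

text \<open>The fixed point of the lower bound \<open>x \<mapsto> (k - 1) x - (k\<mu> + ln a\<^sub>1 - ln a\<^sub>0)\<close> for the next level.\<close>

definition defect :: real where
  "defect = (real k * \<mu> + ln (a 1) - ln (a 0)) / (real k - 2)"

lemma defect_mult: "(real k - 2) * defect = real k * \<mu> + ln (a 1) - ln (a 0)"
  using k_ge_3 by (simp add: defect_def)

lemma defect_3: "k = 3 \<Longrightarrow> defect = 3 * \<mu> + ln (a 1) - ln (a 0)"
  unfolding defect_def by simp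

lemma \<mu>_nonneg: "0 \<le> \<mu>"
  using n_nonzero by auto

lemma ln_nonneg: "i < N \<Longrightarrow> 0 \<le> ln (real (a i))" "i < N \<Longrightarrow> 0 \<le> ln (real (b i))"
  using power_grid_pos[OF grid, of i] by auto

lemma ln_a_mono: "i \<le> j \<Longrightarrow> j < N \<Longrightarrow> ln (real (a i)) \<le> ln (real (a j))"
  using power_grid_less(1)[OF grid, of i j] power_grid_pos(1)[OF grid, of i] by (cases "i = j") auto

lemma rectangle:
  assumes "i < i'" "i' < N" "j < j'" "j' < N"
  shows "solution_rectangle k n (a i) (a i') (b j) (b j')"
  using assms k_ge_3 n_nonzero power_grid_less[OF grid] power_grid_shifted_power[OF grid]
  by unfold_locales auto

lemma gap:
  assumes "i < i'" "i' < N" "j < j'" "j' < N" "0 < i \<or> 0 < j"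
  shows "(real k - 1) * (ln (a i) + ln (b j)) \<le> real k * \<mu> + ln (a i') + ln (b j')"
proof -
  interpret R: solution_rectangle k n "a i" "a i'" "b j" "b j'"
    using assms by (intro rectangle)
  have mono: "f p \<le> f q" if "strict_mono_on {..<N} f" "p \<le> q" "q < N"
    for f :: "nat \<Rightarrow> nat" and p q
    using that by (cases "p = q") (auto simp: strict_mono_on_def intro: less_imp_le)
  have "\<exists>p\<in>corner_products a b. p \<le> real (a i) * real (b j)"
    using assms mono[of a] mono[of b] grid unfolding power_grid_def corner_products_def
    by (elim disjE) (auto intro!: mult_mono)
  then have "4 * \<bar>real_of_int n\<bar> \<le> real (a i) * real (b j)" using large by force
  then show ?thesis by (rule R.gap_principle)
qed

lemma level_growth:
  assumes "0 < j" "j + i < N"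
  shows "(real k - 1) ^ i * (level j - defect) \<le> level (j + i) - defect"
  using assms(2)
proof (induction i)
  case (Suc i)
  have "(real k - 1) * level (j + i) \<le> (real k - 2) * defect + level (j + Suc i)"
    using gap[of 0 1 "j + i" "j + Suc i"] Suc.prems assms(1)
    unfolding defect_mult by (simp add: level_def)
  then have "(real k - 1) * (level (j + i) - defect) \<le> level (j + Suc i) - defect"
    by (simp add: algebra_simps)
  moreover have "(real k - 1) * ((real k - 1) ^ i * (level j - defect))
      \<le> (real k - 1) * (level (j + i) - defect)"
    using Suc k_ge_3 by (intro mult_left_mono) auto
  ultimately show ?case by (simp only: power_Suc mult.assoc)
qed simp

definition log_gain :: "nat \<Rightarrow> real" where
  "log_gain j = level j - ln (a 1) - 2 * \<mu> - 2 * ln k"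

definition log_height :: "nat \<Rightarrow> real" where
  "log_height j = level j + ln (a 1) + 2 * ln k + ln 5"

lemma no_far_column:
  fixes r\<^sub>0 :: nat
  assumes "0 < i" "0 < j" "j + i < N"
    and "ln 16 + \<mu> \<le> level j"
    and "log_height j \<le> (real k - 1) * log_gain j"
    and "real k * \<mu> + ln (a 1) + (real r\<^sub>0 + 1) * log_height j
      \<le> (real k - 2) * level j + (real k - 1) * ((real r\<^sub>0 - 1) * log_gain j)"
    and "real k * (level j + (real r\<^sub>0 - 1) * log_gain j)
      < real k * \<mu> + ln (a 1) - ln (a 0) + level j + level (j + i)"
  shows False
proof -
  interpret R: solution_rectangle k n "a 0" "a 1" "b j" "b (j + i)"
    using assms(1-3) by (intro rectangle) auto
  have "ln R.gain = log_gain j" "ln R.height = log_height j"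
    unfolding R.ln_gain R.ln_height log_gain_def log_height_def level_def by simp_all
  then show False
    using R.no_far_solution[of r\<^sub>0] assms(4-) by (simp add: level_def)
qed

end

lemma ln_numeral_bounds:
  "ln (3::real) \<le> 10/9" "ln (5::real) \<le> 175/108" "7/4 \<le> ln (7::real)" "5/2 \<le> ln (15::real)"
proof -
  have compare: "real p * ln x \<le> real q * ln y" if "x ^ p \<le> y ^ q" "x > 0" "y > 0"
    for x y :: real and p q
    using that ln_le_cancel_iff[of "x ^ p" "y ^ q"] by (simp add: ln_realpow)
  note ln_2 = ln2_ge_two_thirds ln2_le_25_over_36
  show "ln (3::real) \<le> 10/9" using compare[of 3 5 2 8] ln_2 by simp
  show "ln (5::real) \<le> 175/108" using compare[of 5 3 2 7] ln_2 by simp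
  show "7/4 \<le> ln (7::real)" using compare[of 2 11 7 4] ln_2 by simp
  show "5/2 \<le> ln (15::real)" using compare[of 2 15 15 4] ln_2 by simp
qed

lemma ln_4_16: "ln (4::real) = 2 * ln 2" "ln (16::real) = 4 * ln 2"
  using ln_realpow[of "2::real" 2] ln_realpow[of "2::real" 4] by simp_all

lemma ln_le_third:
  fixes x :: real
  assumes "x \<ge> 5"
  shows "ln x \<le> x / 3"
proof -
  have "ln x = ln 5 + ln (x / 5)" using assms by (simp add: ln_div)
  also have "ln (x / 5) \<le> x / 5 - 1" using assms by (intro ln_le_minus_one) auto
  finally show ?thesis using assms ln_numeral_bounds(2) by simp
qed

lemma square_growth_ge:
  fixes x l d :: real
  assumes "6 \<le> x" "0 \<le> l" "2 * ((x - 2) * d) \<le> x * l"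
  shows "(x + 1) * l \<le> (x - 1)\<^sup>2 * (l - d) + d"
proof -
  have "x * (2 * ((x - 2) * d)) \<le> x * (x * l)" using assms by (intro mult_left_mono) auto
  then have "2 * (x * (x * d)) - 4 * (x * d) \<le> x * (x * l)" by (simp only: algebra_simps)
  moreover have "6 * (x * l) \<le> x * (x * l)" using assms by (intro mult_right_mono) auto
  ultimately have "x * l + l \<le> x * (x * l) - 2 * (x * l) + l - (x * (x * d) - 2 * (x * d))" by linarith
  then show ?thesis by (simp add: algebra_simps power2_eq_square)
qed

text \<open>
  The conditions of \<open>no_far_column\<close> for \<open>r\<^sub>0 = 2\<close>, with \<open>x\<close> for \<open>k\<close>, \<open>L\<close> for \<open>ln a\<^sub>1\<close>, \<open>s\<close> for the first level
  and \<open>\<sigma>\<close> for the level at which the comparison takes place.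
\<close>

context
  fixes x \<mu> L s \<sigma> :: real
  assumes x: "x = 4 \<and> 9 * s \<le> \<sigma> \<or> 5 \<le> x \<and> (x + 1) * s \<le> \<sigma>"
    and \<mu>: "0 \<le> \<mu>" "2 * (x + 1) * \<mu> \<le> (x - 2) * s" and L: "L \<le> s" and s: "5/2 \<le> s"
begin

lemma level_products:
  assumes "5 \<le> x"
  shows "x * L \<le> x * s" "x * ln x \<le> x * x / 3" "5/2 * x \<le> x * s" "5 * s \<le> x * s"
    "5/2 * (x * x) \<le> x * x * s" "5 * (x * s) \<le> x * x * s" "2 * (x * \<mu>) + 2 * \<mu> \<le> x * s - 2 * s"
proof -
  show "x * ln x \<le> x * x / 3" using mult_left_mono[OF ln_le_third[OF assms], of x] assms by simp
  show "2 * (x * \<mu>) + 2 * \<mu> \<le> x * s - 2 * s" using \<mu>(2) by (simp add: algebra_simps)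
qed (use assms L s in \<open>simp_all add: mult_right_mono mult_left_mono\<close>)

lemma level_slope_condition: "x * L + 2 * (x - 1) * \<mu> + 2 * x * ln x + ln 5 \<le> (x - 2) * \<sigma>"
  using x
proof (elim disjE conjE)
  assume "5 \<le> x" "(x + 1) * s \<le> \<sigma>"
  then have "(x - 2) * ((x + 1) * s) \<le> (x - 2) * \<sigma>" by (intro mult_left_mono) auto
  then have "x * x * s - x * s - 2 * s \<le> x * \<sigma> - 2 * \<sigma>" by (simp add: algebra_simps)
  then have "x * L + (2 * (x * \<mu>) - 2 * \<mu>) + 2 * (x * ln x) + ln 5 \<le> x * \<sigma> - 2 * \<sigma>"
    using level_products[OF \<open>5 \<le> x\<close>] \<mu>(1) s ln_numeral_bounds(2) by linarith
  then show ?thesis by (simp add: algebra_simps)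
qed (use L \<mu> s ln_4_16 ln_numeral_bounds(2) ln2_le_25_over_36 in simp)

lemma level_base_condition:
  "(x + 3) * L + (3 * x - 2) * \<mu> + 2 * (x + 2) * ln x + 3 * ln 5 \<le> (2 * x - 6) * \<sigma>"
  using x
proof (elim disjE conjE)
  assume "5 \<le> x" "(x + 1) * s \<le> \<sigma>"
  then have "(2 * x - 6) * ((x + 1) * s) \<le> (2 * x - 6) * \<sigma>" by (intro mult_left_mono) auto
  then have "2 * (x * x * s) - 4 * (x * s) - 6 * s \<le> 2 * (x * \<sigma>) - 6 * \<sigma>" by (simp add: algebra_simps)
  then have "x * L + 3 * L + (3 * (x * \<mu>) - 2 * \<mu>) + (2 * (x * ln x) + 4 * ln x) + 3 * ln 5
      \<le> 2 * (x * \<sigma>) - 6 * \<sigma>"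
    using level_products[OF \<open>5 \<le> x\<close>] \<mu>(1) L s ln_le_third[OF \<open>5 \<le> x\<close>] ln_numeral_bounds(2)
    by linarith
  then show ?thesis by (simp add: algebra_simps)
qed (use L \<mu> s ln_4_16 ln_numeral_bounds(2) ln2_le_25_over_36 in simp)

lemma level_far_condition: "x ^ 2 * \<mu> \<le> (x ^ 2 - 4 * x + 2) * \<sigma>"
  using x
proof (elim disjE conjE)
  assume "5 \<le> x" "(x + 1) * s \<le> \<sigma>"
  have "x ^ 2 * \<mu> \<le> x * (x * s)"
  proof -
    have "2 * (x * \<mu>) \<le> x * s" using level_products(7)[OF \<open>5 \<le> x\<close>] \<mu>(1) s by linarith
    moreover have "0 \<le> x * s" using \<open>5 \<le> x\<close> s by simp
    ultimately have "x * \<mu> \<le> x * s" by linarith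
    then have "x * (x * \<mu>) \<le> x * (x * s)" using \<open>5 \<le> x\<close> by (intro mult_left_mono) auto
    then show ?thesis by (simp add: power2_eq_square mult.assoc)
  qed
  also have "\<dots> \<le> (x + 2) * ((x + 1) * s)"
    using \<open>5 \<le> x\<close> s by (intro mult_mono) auto
  also have "\<dots> \<le> (x ^ 2 - 4 * x + 2) * \<sigma>"
  proof (rule mult_mono)
    have "5 * x \<le> x * x" using \<open>5 \<le> x\<close> by (intro mult_right_mono) auto
    then show "x + 2 \<le> x ^ 2 - 4 * x + 2" "0 \<le> x ^ 2 - 4 * x + 2"
      using \<open>5 \<le> x\<close> by (simp_all add: power2_eq_square)
  qed (use \<open>5 \<le> x\<close> \<open>(x + 1) * s \<le> \<sigma>\<close> s in auto)
  finally show ?thesis .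
qed (use \<mu> s in simp)

lemma level_size_condition: "ln 16 + \<mu> \<le> \<sigma>"
  using x
proof (elim disjE conjE)
  assume "5 \<le> x" "(x + 1) * s \<le> \<sigma>"
  have "2 * ((x + 1) * \<mu>) \<le> (x + 1) * s"
    using level_products(7)[OF \<open>5 \<le> x\<close>] s by (simp add: algebra_simps)
  then have "2 * \<mu> \<le> s" using \<open>5 \<le> x\<close> by simp
  moreover have "6 * s \<le> (x + 1) * s" using \<open>5 \<le> x\<close> s by (intro mult_right_mono) auto
  ultimately show ?thesis using \<open>(x + 1) * s \<le> \<sigma>\<close> s ln_4_16(2) ln2_le_25_over_36 by linarith
qed (use \<mu> s ln_4_16 ln2_le_25_over_36 in simp)

end

context large_power_grid
begin

lemma level_ge_if_k_ge_4:
  assumes "k \<ge> 4" "r_bd k \<le> N" "ln (a 1) \<le> level 1" "0 \<le> level 1"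
    and \<mu>: "2 * (real k + 1) * \<mu> \<le> (real k - 2) * level 1"
  shows "real k = 4 \<and> 9 * level 1 \<le> level (r_bd k - 1)
    \<or> 5 \<le> real k \<and> (real k + 1) * level 1 \<le> level (r_bd k - 1)"
proof -
  have "N \<ge> 4" using assms(2) by (auto simp: r_bd_def split: if_splits)
  then have defect: "(real k - 2) * defect \<le> real k * \<mu> + level 1"
    using assms(3) ln_nonneg(1)[of 0] by (simp add: defect_mult)
  have growth: "(real k - 1) ^ (r_bd k - 2) * (level 1 - defect) \<le> level (r_bd k - 1) - defect"
  proof -
    have "1 + (r_bd k - 2) = r_bd k - 1" by (simp add: r_bd_def)
    then show ?thesis using level_growth[of 1 "r_bd k - 2"] assms(2) \<open>N \<ge> 4\<close> by (simp only:)
  qed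
  consider (four) "k = 4" | (five) "k = 5" | (ge_six) "k \<ge> 6" using assms(1) by linarith
  then show ?thesis
  proof cases
    case four
    then show ?thesis using growth defect \<mu> by (simp add: r_bd_def)
  next
    case five
    then show ?thesis using growth defect \<mu> assms(4) by (simp add: r_bd_def)
  next
    case ge_six
    have "2 * (real k * \<mu>) \<le> real k * level 1 - 2 * level 1"
      using \<mu> \<mu>_nonneg by (simp add: algebra_simps)
    then have "2 * ((real k - 2) * defect) \<le> real k * level 1" using defect by linarith
    then have "(real k + 1) * level 1 \<le> (real k - 1)\<^sup>2 * (level 1 - defect) + defect"
      using ge_six assms(4) by (intro square_growth_ge) auto
    then show ?thesis using growth ge_six by (simp add: r_bd_def)
  qed
qed

lemma no_grid_k_ge_4_ordered:
  assumes "k \<ge> 4" "r_bd k + 2 \<le> N" "a 1 \<le> b 1" "5/2 \<le> level 1"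
    and \<mu>: "2 * (real k + 1) * \<mu> \<le> (real k - 2) * level 1"
  shows False
proof -
  define j where "j = r_bd k - 1"
  have j: "0 < j" "j + 2 < N" "1 < N" using assms(2) by (auto simp: j_def r_bd_def)
  have "ln (real (a 1)) \<le> ln (real (b 1))" using assms(3) power_grid_pos[OF grid j(3)] by simp
  then have ln_a1: "ln (a 1) \<le> level 1" using ln_nonneg(1)[of 0] j by (simp add: level_def)
  have "real k = 4 \<and> 9 * level 1 \<le> level j \<or> 5 \<le> real k \<and> (real k + 1) * level 1 \<le> level j"
    unfolding j_def using assms ln_a1 by (intro level_ge_if_k_ge_4) auto
  note conditions = this \<mu>_nonneg \<mu> ln_a1 assms(4)
  show False
  proof (rule no_far_column[of 2 j 2])
    show "log_height j \<le> (real k - 1) * log_gain j"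
      using level_slope_condition[OF conditions] by (simp add: log_gain_def log_height_def algebra_simps)
    show "real k * \<mu> + ln (a 1) + (real 2 + 1) * log_height j
        \<le> (real k - 2) * level j + (real k - 1) * ((real 2 - 1) * log_gain j)"
      using level_base_condition[OF conditions] by (simp add: log_gain_def log_height_def algebra_simps)
    have "(real k - 1)\<^sup>2 * level j - real k * ((real k - 2) * defect) \<le> level (j + 2)"
      using level_growth[OF j(1,2)] by (simp add: algebra_simps power2_eq_square)
    moreover have "0 < real k * ln k" "0 \<le> real k * ln (a 0) - ln (a 0)" "0 \<le> real k * \<mu>"
      using assms(1) ln_nonneg(1)[of 0] j \<mu>_nonneg by (simp_all add: mult_le_cancel_right1)
    moreover have "0 \<le> ln (a 1)" using ln_nonneg(1)[of 1] j by simp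
    ultimately show "real k * (level j + (real 2 - 1) * log_gain j)
        < real k * \<mu> + ln (a 1) - ln (a 0) + level j + level (j + 2)"
      using level_far_condition[OF conditions] unfolding defect_mult
      by (simp add: log_gain_def algebra_simps power2_eq_square)
  qed (use j level_size_condition[OF conditions] in auto)
qed

lemma no_grid_k_ge_4:
  assumes "k \<ge> 4" "r_bd k + 2 \<le> N"
    and corners: "\<And>p. p \<in> corner_products a b \<Longrightarrow>
      5/2 \<le> ln p \<and> 2 * (real k + 1) * \<mu> \<le> (real k - 2) * ln p"
  shows False
proof -
  interpret swap: large_power_grid k n N b a by (rule large_power_grid_swap)
  have "5/2 \<le> level 1 \<and> 2 * (real k + 1) * \<mu> \<le> (real k - 2) * level 1"
    "5/2 \<le> swap.level 1 \<and> 2 * (real k + 1) * \<mu> \<le> (real k - 2) * swap.level 1"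
    using level_1_corner_product corners assms(2)
      swap.level_1_corner_product[unfolded corner_products_commute[of b a]]
    by force+
  then show False
    using no_grid_k_ge_4_ordered[OF assms(1,2)] swap.no_grid_k_ge_4_ordered[OF assms(1,2)]
    by linarith
qed

lemma no_grid_k_eq_3_if_level_2_large:
  assumes "k = 3" "i + 7 \<le> N" "ln (a 1) \<le> 2 * s" "s - 9/2 * \<mu> \<le> level 2 - defect - ln (a 0)"
    and large: "8 * s + 6 * \<mu> + 14 \<le> 2 ^ i * (s - 9/2 * \<mu>)"
  shows False
proof -
  define j where "j = i + 2"
  have j: "0 < j" "j + 4 < N" using assms(2) by (auto simp: j_def)
  have logs_nonneg: "0 \<le> ln (a 0)" "ln (a 0) \<le> ln (a 1)" "0 \<le> ln (3::real)"
    using ln_nonneg(1)[of 0] ln_a_mono[of 0 1] j by auto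
  have "8 * s + 6 * \<mu> + 14 + ln (a 0) \<le> 2 ^ i * (s - 9/2 * \<mu>) + 2 ^ i * ln (a 0)"
    using large logs_nonneg mult_right_mono[of 1 "2 ^ i" "ln (real (a 0))"] by simp
  also have "\<dots> \<le> 2 ^ i * (level 2 - defect)"
    using assms(4) by (simp flip: distrib_left)
  also have "\<dots> \<le> level j - defect"
    using level_growth[of 2 i] assms(1) j by (simp add: j_def add.commute)
  finally have level: "5 * ln (a 1) + 9 * \<mu> + 14 \<le> level j"
    using assms(3) logs_nonneg unfolding defect_3[OF assms(1)] by linarith
  have growth: "16 * level j \<le> level (j + 4) + 15 * (3 * \<mu> + ln (a 1) - ln (a 0))"
    using level_growth[of j 4] j assms(1) unfolding defect_3[OF assms(1)] by simp
  note bounds = level logs_nonneg \<mu>_nonneg ln_4_16 ln2_le_25_over_36 ln_numeral_bounds(1,2)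
  have log_gain_height: "log_gain j = level j - ln (a 1) - 2 * \<mu> - 2 * ln 3"
    "log_height j = level j + ln (a 1) + 2 * ln 3 + ln 5"
    unfolding log_gain_def log_height_def unfolding assms(1) by simp_all
  show False
  proof (rule no_far_column[of 4 j 5])
    show "ln 16 + \<mu> \<le> level j" using bounds by simp
    show "log_height j \<le> (real k - 1) * log_gain j"
      using bounds unfolding log_gain_height unfolding assms(1) of_nat_numeral by argo
    show "real k * \<mu> + ln (a 1) + (real 5 + 1) * log_height j
        \<le> (real k - 2) * level j + (real k - 1) * ((real 5 - 1) * log_gain j)"
      using bounds unfolding log_gain_height unfolding assms(1) of_nat_numeral by argo
    show "real k * (level j + (real 5 - 1) * log_gain j)
        < real k * \<mu> + ln (a 1) - ln (a 0) + level j + level (j + 4)"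
      using growth bounds unfolding log_gain_height unfolding assms(1) of_nat_numeral by argo
  qed (use j in simp_all)
qed

text \<open>
  For \<open>k = 3\<close> the defect can be as large as the first level, so that growth has to be started by hand: either
  one corner product is at least the square of the other, or the gap from \<open>(a\<^sub>1, b\<^sub>1)\<close> to \<open>(a\<^sub>2, b\<^sub>2)\<close> makes the
  larger one of \<open>a\<^sub>2\<close> and \<open>b\<^sub>2\<close> large.
\<close>

lemma no_grid_k_eq_3_skew:
  assumes "k = 3" "i + 7 \<le> N"
    and s: "s = ln (a 1) + ln (b 0)" "2 * s \<le> level 1"
    and large: "8 * s + 6 * \<mu> + 14 \<le> 2 ^ i * (s - 9/2 * \<mu>)"
  shows False
proof (rule no_grid_k_eq_3_if_level_2_large[OF assms(1,2) _ _ large])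
  have logs_nonneg: "0 \<le> ln (a 0)" "0 \<le> ln (a 1)" "0 \<le> ln (b 0)"
    using ln_nonneg[of 0] ln_nonneg[of 1] assms(2) by auto
  then show "ln (a 1) \<le> 2 * s" by (simp add: s(1))
  have "0 < 2 ^ i * (s - 9/2 * \<mu>)" using large logs_nonneg \<mu>_nonneg s(1) by linarith
  then have "0 < s - 9/2 * \<mu>" by (simp add: zero_less_mult_iff)
  moreover have "2 * (level 1 - defect) \<le> level 2 - defect"
    using level_growth[of 1 1] assms(1,2) by (simp add: numeral_2_eq_2)
  ultimately show "s - 9/2 * \<mu> \<le> level 2 - defect - ln (a 0)"
    using s logs_nonneg \<mu>_nonneg unfolding defect_3[OF assms(1)] by simp
qed

lemma no_grid_k_eq_3_balanced:
  assumes "k = 3" "i + 7 \<le> N" "a 2 \<le> b 2" "ln (a 1) + ln (b 0) \<le> 2 * level 1"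
    and large: "8 * level 1 + 6 * \<mu> + 14 \<le> 2 ^ i * (level 1 - 9/2 * \<mu>)"
  shows False
proof (rule no_grid_k_eq_3_if_level_2_large[OF assms(1,2) _ _ large])
  show "ln (a 1) \<le> 2 * level 1" using assms(2,4) ln_nonneg(2)[of 0] by simp
  have "ln (real (a 2)) \<le> ln (real (b 2))"
    using assms(2,3) power_grid_pos[OF grid, of 2] by simp
  moreover have "2 * (ln (a 1) + ln (b 1)) \<le> 3 * \<mu> + ln (a 2) + ln (b 2)"
    using gap[of 1 2 1 2] assms(1,2) by simp
  ultimately show "level 1 - 9/2 * \<mu> \<le> level 2 - defect - ln (a 0)"
    unfolding defect_3[OF assms(1)] level_def by simp
qed

lemma no_grid_k_eq_3:
  assumes "k = 3" "i + 7 \<le> N"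
    and corners: "\<And>p. p \<in> corner_products a b \<Longrightarrow>
      8 * ln p + 6 * \<mu> + 14 \<le> 2 ^ i * (ln p - 9/2 * \<mu>)"
  shows False
proof -
  interpret swap: large_power_grid k n N b a by (rule large_power_grid_swap)
  have large: "8 * level 1 + 6 * \<mu> + 14 \<le> 2 ^ i * (level 1 - 9/2 * \<mu>)"
    "8 * swap.level 1 + 6 * \<mu> + 14 \<le> 2 ^ i * (swap.level 1 - 9/2 * \<mu>)"
    using level_1_corner_product corners assms(2)
      swap.level_1_corner_product[unfolded corner_products_commute[of b a]]
    by force+
  have levels: "level 1 = ln (b 1) + ln (a 0)" "swap.level 1 = ln (a 1) + ln (b 0)"
    unfolding level_def swap.level_def by simp_all
  consider (skew) "2 * swap.level 1 \<le> level 1" | (swap_skew) "2 * level 1 \<le> swap.level 1"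
    | (balanced) "swap.level 1 \<le> 2 * level 1" "a 2 \<le> b 2"
    | (swap_balanced) "level 1 \<le> 2 * swap.level 1" "b 2 \<le> a 2"
    by linarith
  then show False
  proof cases
    case skew
    then show False using no_grid_k_eq_3_skew[OF assms(1,2) levels(2)] large(2) by simp
  next
    case swap_skew
    then show False using swap.no_grid_k_eq_3_skew[OF assms(1,2) levels(1)] large(1) by simp
  next
    case balanced
    then show False using no_grid_k_eq_3_balanced[OF assms(1,2)] large(1) levels(2) by simp
  next
    case swap_balanced
    then show False
      using swap.no_grid_k_eq_3_balanced[OF assms(1,2)] large(2) levels(1) by (simp add: add.commute)
  qed
qed

end

section \<open>Bounding the size of bipartite tuples\<close>

lemma two_power_le_unit_shift:
  assumes "shifted_power k n a b" "shifted_power k n a b'" "b < b'" "\<bar>n\<bar> = 1"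
  shows "2 ^ k \<le> real a * real b' + 1"
proof -
  obtain x y :: nat where x: "x \<ge> 1" "int a * int b + n = int x ^ k"
    and y: "y \<ge> 1" "int a * int b' + n = int y ^ k" and "a > 0"
    using assms(1,2) by (auto simp: shifted_power_def)
  have "int a * int b < int a * int b'" using \<open>a > 0\<close> assms(3) by simp
  moreover have "1 \<le> int x ^ k" using x(1) by simp
  ultimately have "int y ^ k \<noteq> 1" using x(2) y(2) by linarith
  then have "y \<noteq> 1" by auto
  then have "int 2 ^ k \<le> int y ^ k" using y(1) by (intro power_mono) auto
  then have "2 ^ k \<le> int a * int b' + 1" using y(2) assms(4) by simp
  then have "real_of_int (2 ^ k) \<le> real_of_int (int a * int b' + 1)" by (simp only: of_int_le_iff)
  then show ?thesis by simp
qed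

lemma two_power_le_unit_corners:
  assumes "power_grid k n N a b" "1 < N" "\<bar>n\<bar> = 1" "p \<in> corner_products a b"
  shows "2 ^ k \<le> p + 1"
  using assms(2-4) power_grid_less[OF assms(1), of 0 1]
    power_grid_shifted_power[OF assms(1)] power_grid_shifted_power[OF power_grid_commute[OF assms(1)]]
    two_power_le_unit_shift[of k n "a 0" "b 0" "b 1"] two_power_le_unit_shift[of k n "b 0" "a 0" "a 1"]
  by (auto simp: corner_products_def mult.commute)

lemma no_power_grid_unit:
  assumes k: "k \<ge> 3" and n: "\<bar>n\<bar> = 1" and ab: "power_grid k n (r_bd k + 2) a b"
  shows False
proof -
  have abs_n: "\<bar>real_of_int n\<bar> = 1" using n by (metis of_int_1 of_int_abs)
  have power: "2 ^ k \<le> p + 1" if "p \<in> corner_products a b" for p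
    using two_power_le_unit_corners[OF ab _ n that] by simp
  have "(8::real) \<le> 2 ^ k" using power_increasing[OF k, of "2::real"] by simp
  then have "4 \<le> p" if "p \<in> corner_products a b" for p using power[OF that] by linarith
  then interpret large_power_grid k n "r_bd k + 2" a b
    using k n ab abs_n by unfold_locales auto
  have ln_product: "ln c \<le> ln p" if "p \<in> corner_products a b" "0 < c" "c + 1 \<le> 2 ^ k" for c p
    using power[OF that(1)] that(2,3) by simp
  show False
  proof (cases "k = 3")
    case True
    show False
    proof (rule no_grid_k_eq_3[OF True, of 4])
      fix p assume "p \<in> corner_products a b"
      then have "ln 7 \<le> ln p" using ln_product[of p 7] True by simp
      then show "8 * ln p + 6 * \<mu> + 14 \<le> 2 ^ 4 * (ln p - 9/2 * \<mu>)"
        using ln_numeral_bounds(3) by (simp add: abs_n)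
    qed (simp add: True r_bd_def)
  next
    case False
    then have sixteen: "(16::real) \<le> 2 ^ k" using power_increasing[of 4 k "2::real"] k by simp
    show False
    proof (rule no_grid_k_ge_4)
      fix p assume "p \<in> corner_products a b"
      then have "ln 15 \<le> ln p" using ln_product[of p 15] sixteen by simp
      then have "5/2 \<le> ln p" using ln_numeral_bounds(4) by linarith
      then show "5/2 \<le> ln p \<and> 2 * (real k + 1) * \<mu> \<le> (real k - 2) * ln p"
        using k by (simp add: abs_n)
    qed (use k False in simp_all)
  qed
qed

definition product_threshold :: "nat \<Rightarrow> int \<Rightarrow> real" where
  "product_threshold k n =
    max (4 * (real_of_int \<bar>n\<bar>)\<^sup>2) (real_of_int \<bar>n\<bar> powr (2 * (real k + 1) / (real k - 2)))"

lemma product_threshold_bounds: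
  assumes "k \<ge> 3" "\<bar>n\<bar> \<ge> 2" "product_threshold k n \<le> p"
  shows "4 * \<bar>real_of_int n\<bar> \<le> p" "8/3 \<le> ln p"
    "2 * (real k + 1) * ln \<bar>real_of_int n\<bar> \<le> (real k - 2) * ln p"
proof -
  define \<nu> where "\<nu> = \<bar>real_of_int n\<bar>"
  have \<nu>: "2 \<le> \<nu>" using assms(2) unfolding \<nu>_def by linarith
  have p: "4 * \<nu>\<^sup>2 \<le> p" "\<nu> powr (2 * (real k + 1) / (real k - 2)) \<le> p"
    using assms(3) by (simp_all add: product_threshold_def \<nu>_def)
  have "\<nu> * 2 \<le> \<nu> * \<nu>" using \<nu> by (intro mult_left_mono) auto
  then have large: "4 * \<nu> \<le> p" "16 \<le> p" using p(1) \<nu> unfolding power2_eq_square by linarith+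
  then show "4 * \<bar>real_of_int n\<bar> \<le> p" by (simp add: \<nu>_def)
  have "ln 16 \<le> ln p" using large by simp
  then show "8/3 \<le> ln p" using ln_4_16(2) ln2_ge_two_thirds by linarith
  have "2 * (real k + 1) / (real k - 2) * ln \<nu> = ln (\<nu> powr (2 * (real k + 1) / (real k - 2)))"
    using \<nu> by (simp add: ln_powr)
  also have "\<dots> \<le> ln p" using p(2) \<nu> large by (subst ln_le_cancel_iff) auto
  finally have "(real k - 2) * (2 * (real k + 1) / (real k - 2) * ln \<nu>) \<le> (real k - 2) * ln p"
    using assms(1) by (intro mult_left_mono) auto
  then show "2 * (real k + 1) * ln \<bar>real_of_int n\<bar> \<le> (real k - 2) * ln p"
    using assms(1) by (simp add: \<nu>_def)
qed

lemma no_power_grid_beyond_threshold: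
  assumes k: "k \<ge> 3" and n: "\<bar>n\<bar> \<ge> 2" and ab: "power_grid k n N a b" and N: "14 \<le> N"
    and beyond: "\<And>p. p \<in> corner_products a b \<Longrightarrow> product_threshold k n \<le> p"
  shows False
proof -
  note bounds = product_threshold_bounds[OF k n beyond]
  interpret large_power_grid k n N a b
    using k n ab bounds(1) by unfold_locales auto
  show False
  proof (cases "k = 3")
    case True
    show False
    proof (rule no_grid_k_eq_3[OF True, of 7])
      fix p assume "p \<in> corner_products a b"
      then show "8 * ln p + 6 * \<mu> + 14 \<le> 2 ^ 7 * (ln p - 9/2 * \<mu>)"
        using bounds(2,3)[of p] \<mu>_nonneg by (simp add: True)
    qed (use N in simp)
  next
    case False
    show False
    proof (rule no_grid_k_ge_4)
      show "r_bd k + 2 \<le> N" using N by (simp add: r_bd_def)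
      fix p assume "p \<in> corner_products a b"
      then show "5/2 \<le> ln p \<and> 2 * (real k + 1) * \<mu> \<le> (real k - 2) * ln p"
        using bounds(2,3)[of p] by simp
    qed (use k False in simp)
  qed
qed

lemma strict_mono_enumeration:
  fixes A :: "'a::wellorder set"
  assumes "enat N \<le> ecard A"
  obtains f where "strict_mono_on {..<N} f" "f ` {..<N} \<subseteq> A"
proof -
  obtain C where C: "C \<subseteq> A" "finite C" "card C = N"
  proof (cases "finite A")
    case True
    then have "N \<le> card A" using assms by (simp add: ecard_def)
    then show ?thesis using that obtain_subset_with_card_n by metis
  next
    case False
    then show ?thesis using that infinite_arbitrarily_large by metis
  qed
  obtain f where "bij_betw f {..<card C} C" "strict_mono_on {..<card C} f"
    using ex_bij_betw_strict_mono_card[OF C(2)] by metis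
  then show ?thesis using that C by (auto simp: bij_betw_def)
qed

lemma ecard_Diff_ge:
  assumes "enat (F + N) \<le> ecard B" "finite C" "card C \<le> F" "C \<subseteq> B"
  shows "enat N \<le> ecard (B - C)"
  using assms by (auto simp: ecard_def card_Diff_subset)

lemma BD_shifted_power:
  assumes "BD k n A B" "a \<in> A" "b \<in> B"
  shows "shifted_power k n a b"
proof -
  have "a \<ge> 1" "b \<ge> 1" using assms unfolding BD_def by (meson atLeast_iff subsetD)+
  moreover have "int a * int b + n \<in> {int x ^ k | x :: nat. x \<ge> 1}"
    using assms unfolding BD_def by blast
  ultimately show ?thesis unfolding shifted_power_def by auto
qed

lemma card_shifted_powers_le:
  assumes "k > 0" and B: "\<And>b. b \<in> B \<Longrightarrow> shifted_power k n a b \<and> real a * real b \<le> M"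
  defines "F \<equiv> nat \<lfloor>(M + real_of_int n) powr (1 / real k)\<rfloor>"
  shows "finite B" "card B \<le> F"
proof -
  have inj: "inj_on (shifted_root k n a) B"
  proof (rule inj_onI)
    fix b c assume bc: "b \<in> B" "c \<in> B" and "shifted_root k n a b = shifted_root k n a c"
    then have "real a * real b = real a * real c"
      using shifted_root_power[of k n a] B[OF bc(1)] B[OF bc(2)] assms(1) by (metis add_right_cancel)
    moreover have "0 < a" using B[OF bc(1)] by (simp add: shifted_power_def)
    ultimately show "b = c" by simp
  qed
  have image: "shifted_root k n a ` B \<subseteq> real ` {1..F}"
  proof
    fix x assume "x \<in> shifted_root k n a ` B"
    then obtain b where b: "b \<in> B" "x = shifted_root k n a b" by auto
    note root = shifted_root[OF conjunct1[OF B[OF b(1)]] assms(1)]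
    obtain m where m: "x = real m" using root(1) b(2) by (auto elim: Nats_cases)
    have "0 \<le> real a * real b + real_of_int n" using root(2,3) by (metis less_imp_le zero_less_power)
    then have "x \<le> (M + real_of_int n) powr (1 / real k)"
      unfolding b(2) shifted_root_def using B[OF b(1)] by (intro powr_mono2) auto
    then have "m \<in> {1..F}" using root(2) b(2) m by (simp add: F_def le_nat_floor)
    then show "x \<in> real ` {1..F}" using m by blast
  qed
  show "finite B"
    using inj image by (meson finite_atLeastAtMost finite_imageD finite_imageI finite_subset)
  have "card B = card (shifted_root k n a ` B)" using inj by (simp add: card_image)
  also have "\<dots> \<le> card (real ` {1..F})" by (intro card_mono image) simp
  finally show "card B \<le> F" by (simp add: card_image)
qed

lemma BM_le:
  assumes no_tuple: "\<And>A B. BD k n A B \<Longrightarrow>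
    enat (Suc L) \<le> ecard A \<Longrightarrow> enat (Suc L) \<le> ecard B \<Longrightarrow> False"
  shows "BM k n \<le> enat L"
  unfolding BM_def
proof (rule Sup_least)
  fix m assume "m \<in> {min (ecard A) (ecard B) |A B. BD k n A B}"
  then obtain A B where m: "m = min (ecard A) (ecard B)" "BD k n A B" by auto
  show "m \<le> enat L"
  proof (rule ccontr)
    assume "\<not> m \<le> enat L"
    then have "eSuc (enat L) \<le> m" by (simp add: ileI1)
    then show False using no_tuple[OF m(2)] m(1) by (simp add: eSuc_enat)
  qed
qed

lemma BM_le_if_no_grid_beyond:
  assumes "k > 0"
    and no_grid: "\<And>a b. power_grid k n (Suc N) a b \<Longrightarrow>
      (\<And>j. j \<le> N \<Longrightarrow> M < real (a 0) * real (b j)) \<Longrightarrow> False"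
  shows "BM k n \<le> enat (nat \<lfloor>(M + real_of_int n) powr (1 / real k)\<rfloor> + N)"
    (is "_ \<le> enat (?F + N)")
proof (rule BM_le)
  fix A B assume BD: "BD k n A B"
    and card: "enat (Suc (?F + N)) \<le> ecard A" "enat (Suc (?F + N)) \<le> ecard B"
  have "enat (Suc N) \<le> ecard A" by (rule order_trans[OF _ card(1)]) simp
  then obtain a where a: "strict_mono_on {..<Suc N} a" "a ` {..<Suc N} \<subseteq> A"
    by (rule strict_mono_enumeration)
  define C where "C = {b \<in> B. real (a 0) * real b \<le> M}"
  have "finite C" "card C \<le> ?F"
    using a(2) assms(1)
    by (intro card_shifted_powers_le[of k C n "a 0" M]; auto simp: C_def intro: BD_shifted_power[OF BD])+
  then have "enat (Suc N) \<le> ecard (B - C)"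
    using card(2) by (intro ecard_Diff_ge[of ?F]) (auto simp: C_def)
  then obtain b where b: "strict_mono_on {..<Suc N} b" "b ` {..<Suc N} \<subseteq> B - C"
    by (rule strict_mono_enumeration)
  have "power_grid k n (Suc N) a b"
    using a b unfolding power_grid_def by (auto intro!: BD_shifted_power[OF BD])
  moreover have "M < real (a 0) * real (b j)" if "j \<le> N" for j
    using b(2) that by (auto simp: C_def image_subset_iff not_le dest!: bspec[of _ _ j])
  ultimately show False by (rule no_grid)
qed

lemma BM_le_unit:
  assumes "k \<ge> 3" "\<bar>n\<bar> = 1"
  shows "BM k n \<le> enat (r_bd k + 1)"
proof -
  have "BM k n \<le> enat (nat \<lfloor>(- real_of_int n + real_of_int n) powr (1 / real k)\<rfloor> + (r_bd k + 1))"
    using assms(1) no_power_grid_unit[OF assms] by (intro BM_le_if_no_grid_beyond) auto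
  then show ?thesis by simp
qed

lemma BM_le_threshold:
  assumes k: "k \<ge> 3" and n: "\<bar>n\<bar> \<ge> 2"
  shows "BM k n \<le> enat (nat \<lfloor>(product_threshold k n + real_of_int n) powr (1 / real k)\<rfloor> + 20)"
proof (rule BM_le_if_no_grid_beyond)
  fix a b assume grid: "power_grid k n (Suc 20) a b"
    and beyond: "\<And>j. j \<le> 20 \<Longrightarrow> product_threshold k n < real (a 0) * real (b j)"
  have "real (a 0) * real (b 0) \<le> real (a 1) * real (b 0)"
    using power_grid_less(1)[OF grid, of 0 1] by (intro mult_right_mono) auto
  then have "product_threshold k n \<le> p" if "p \<in> corner_products a b" for p
    using that beyond[of 0] beyond[of 1] by (auto simp: corner_products_def)
  then show False by (rule no_power_grid_beyond_threshold[OF k n grid, rotated]) simp_all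
qed (use k in simp)

theorem theorem2p1:
  fixes k :: nat and n :: int
  assumes "k \<ge> 3" and "n \<noteq> 0"
  shows "(\<bar>n\<bar> = 1 \<longrightarrow> BM k n \<le> enat (r_bd k + 1)) \<and>
         (\<bar>n\<bar> \<ge> 2 \<longrightarrow>
            ereal_of_enat (BM k n) \<le> ereal (max
              ((ln (ln (real_of_int \<bar>n\<bar>)) + 3.3) / ln (real k - 1) + 8)
              ((max (4 * (real_of_int \<bar>n\<bar>)\<^sup>2)
                    (real_of_int \<bar>n\<bar> powr (2 * (real k + 1) / (real k - 2)))
                + real_of_int n) powr (1 / real k) + 20)))"
proof (intro conjI impI)
  assume "\<bar>n\<bar> = 1"
  with assms(1) show "BM k n \<le> enat (r_bd k + 1)" by (rule BM_le_unit)
next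
  assume n: "\<bar>n\<bar> \<ge> 2"
  let ?R = "(product_threshold k n + real_of_int n) powr (1 / real k)"
  have "ereal_of_enat (BM k n) \<le> ereal_of_enat (enat (nat \<lfloor>?R\<rfloor> + 20))"
    using BM_le_threshold[OF assms(1) n] by (simp only: ereal_of_enat_le_iff)
  also have "\<dots> \<le> ereal (?R + 20)" by simp
  also have "\<dots> \<le> ereal (max ((ln (ln (real_of_int \<bar>n\<bar>)) + 3.3) / ln (real k - 1) + 8) (?R + 20))" by simp
  finally show "ereal_of_enat (BM k n) \<le> ereal (max
      ((ln (ln (real_of_int \<bar>n\<bar>)) + 3.3) / ln (real k - 1) + 8)
      ((max (4 * (real_of_int \<bar>n\<bar>)\<^sup>2) (real_of_int \<bar>n\<bar> powr (2 * (real k + 1) / (real k - 2)))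
        + real_of_int n) powr (1 / real k) + 20))"
    unfolding product_threshold_def .
qed

end
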